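(* The quantum version of the Poisson algebra on pairs $(\mathbb A,B)$ of type (ii) (recalled in the context) reads: $$R_{12}(q)\overset{1}{\mathbb A}R_{12}^{t_1}(q)\overset{2}{\mathbb A}=\overset{2}{\mathbb A}R_{12}^{t_1}(q)\overset{1}{\mathbb A}R_{12}(q),$$ $$R_{12}(q)\overset{1}{B}\overset{2}{B}=\overset{2}{B}\overset{1}{B}R_{12}(q),$$ $$\overset{2}{\mathbb A}\overset{1}{B}R_{12}(q)=\overset{1}{B}R_{12}^{t_2}(q^{-1})\overset{2}{\mathbb A}.$$ These commutation relations satisfy the Jacobi relations and ensure the quantum automorphism: the products $\mathbb A'=B\mathbb AB^{\mathrm T}$ satisfy the same quantum algebra, $R_{12}(q)\overset{1}{\mathbb A'}R_{12}^{t_1}(q)\overset{2}{\mathbb A'}=\overset{2}{\mathbb A'}R_{12}^{t_1}(q)\overset{1}{\mathbb A'}R_{12}(q)$.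
   Context: $E_{i,j}$ are the $N\times N$ matrix units, $I$ the $N\times N$ identity. The trigonometric quantum $R$-matrix is $$R_{12}(q)=I\otimes I+\sum_{k,l}E_{k,l}\otimes E_{l,k}\Bigl[(q-q^{-1})\theta(l-k)+\frac{(q^{1/2}-q^{-1/2})^2}{2}\delta_{k,l}\Bigr],$$ with $\theta(x)=1$ for $x>0$, $\theta(0)=1/2$, $\theta(x)=0$ for $x<0$. $\mathbb A=\sum E_{i,j}\otimes a_{i,j}$ and $B=\sum E_{i,j}\otimes b_{i,j}$ are matrices whose entries are operators (elements of a noncommutative associative algebra) commuting with the entries of $R_{12}(q)$; $\overset{1}{X}$, $\overset{2}{X}$ denote $X$ acting in the first, second classical tensor factor; $t_1,t_2$ denote transposition in the first, second classical factor. The order of multiplication of operators is the natural one: it coincides with the ordering of the matrices in matrix products; $(B^{\mathrm T})_{i,j}=b_{j,i}$. "Jacobi relations" means consistency of the quadratic relations on triples: using the relations, the two ways of reversing the order of a product of three of the matrices (in spaces $1,2,3$, e.g. for the triples $(\mathbb A,\mathbb A,B)$ and $(\mathbb A,B,B)$) give the same result. The type (ii) Poisson algebra is: with $r_{12}=\sum_iE_{i,i}\otimes E_{i,i}+2\sum_{i>j}E_{i,j}\otimes E_{j,i}$, $\{\overset{1}{\mathbb A},\overset{2}{\mathbb A}\}=r_{12}\overset{1}{\mathbb A}\overset{2}{\mathbb A}-\overset{1}{\mathbb A}\overset{2}{\mathbb A}r_{12}+\overset{1}{\mathbb A}r_{12}^{t_1}\overset{2}{\mathbb A}-\overset{2}{\mathbb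 A}r_{12}^{t_1}\overset{1}{\mathbb A}$, $\{\overset{1}{B},\overset{2}{B}\}=r_{12}\overset{1}{B}\overset{2}{B}-\overset{1}{B}\overset{2}{B}r_{12}$, $\{\overset{1}{B},\overset{2}{\mathbb A}\}=-\overset{1}{B}r_{12}^{t_2}\overset{2}{\mathbb A}-\overset{1}{B}\overset{2}{\mathbb A}r_{12}$.
   Formalization: The classical limit of the quantum relations is shown to be the type (ii) Poisson brackets only after reversing the order of the matrix indices, since R_12(q) has its off-diagonal terms at k<l while r_12 has them at i>j, so the literal limit fails for N≥2. *)

theory Defs
  imports
    "HOL-Analysis.Cartesian_Space"
    "HOL-Library.Poly_Mapping"
    "HOL-Computational_Algebra.Formal_Power_Series"
begin

text \<open>
  The index type \<open>'n\<close> is an arbitrary nonempty finite linear order, so it stands for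
  \<open>{1, \<dots>, N}\<close>. An element of \<open>End(V) \<otimes> End(V) \<otimes> \<A>\<close> is a matrix over the
  operator algebra \<open>\<A>\<close> whose rows and columns are indexed by \<open>'n \<times> 'n\<close>. The product
  \<open>**\<close> multiplies entries in the order of the matrices, also when the entries do
  not commute.
\<close>

subsection \<open>Matrices on two tensor factors\<close>

type_synonym ('a, 'n) mat1 = "'a^'n^'n"
type_synonym ('a, 'n) mat2 = "'a^('n \<times> 'n)^('n \<times> 'n)"

definition mat_unit :: "'n::finite \<Rightarrow> 'n \<Rightarrow> ('a::semiring_1, 'n) mat1" where
  "mat_unit k l = (\<chi> i j. if i = k \<and> j = l then 1 else 0)"

definition tensor :: "('a::semiring_1, 'n::finite) mat1 \<Rightarrow> ('a, 'n) mat1 \<Rightarrow> ('a, 'n) mat2" where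
  "tensor X Y = (\<chi> p q. X $ fst p $ fst q * Y $ snd p $ snd q)"

definition leg1 :: "('a::semiring_1, 'n::finite) mat1 \<Rightarrow> ('a, 'n) mat2" where
  "leg1 X = tensor X (mat 1)"

definition leg2 :: "('a::semiring_1, 'n::finite) mat1 \<Rightarrow> ('a, 'n) mat2" where
  "leg2 X = tensor (mat 1) X"

definition transp1 :: "('a, 'n::finite) mat2 \<Rightarrow> ('a, 'n) mat2" where
  "transp1 X = (\<chi> p q. X $ (fst q, snd p) $ (fst p, snd q))"

definition transp2 :: "('a, 'n::finite) mat2 \<Rightarrow> ('a, 'n) mat2" where
  "transp2 X = (\<chi> p q. X $ (fst p, snd q) $ (fst q, snd p))"

subsection \<open>The quantum R-matrix\<close>

text \<open>\<open>theta l k\<close> is the step function \<open>\<theta>(l - k)\<close>.\<close>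

definition theta :: "'n::linorder \<Rightarrow> 'n \<Rightarrow> 'c::{comm_ring_1,inverse}" where
  "theta l k = (if k < l then 1 else if k = l then 1 / 2 else 0)"

text \<open>
  The argument \<open>s\<close> is \<open>q\<^sup>1\<^sup>/\<^sup>2\<close>, so \<open>q = s\<^sup>2\<close>, and \<open>qR (inverse s)\<close> is \<open>R\<^sub>1\<^sub>2(q\<^sup>-\<^sup>1)\<close>. The
  sort \<open>{comm_ring_1, inverse}\<close> covers fields and formal power series over a field.
\<close>

definition qR :: "'c::{comm_ring_1,inverse} \<Rightarrow> ('c, 'n::{finite,linorder}) mat2" where
  "qR s = tensor (mat 1) (mat 1) +
     (\<Sum>k\<in>UNIV. \<Sum>l\<in>UNIV. map_matrix
        ((*) ((s\<^sup>2 - inverse (s\<^sup>2)) * theta l k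
              + (s - inverse s)\<^sup>2 / 2 * (if k = l then 1 else 0)))
        (tensor (mat_unit k l) (mat_unit l k)))"

subsection \<open>The quantum algebra\<close>

text \<open>
  An associative unital algebra over the commutative ring \<open>'c\<close>, given by its structure map
  into the centre.
\<close>

definition algebra_map :: "('c::comm_ring_1 \<Rightarrow> 'r::ring_1) \<Rightarrow> bool" where
  "algebra_map \<iota> \<longleftrightarrow> \<iota> 1 = 1 \<and> (\<forall>x y. \<iota> (x + y) = \<iota> x + \<iota> y) \<and>
     (\<forall>x y. \<iota> (x * y) = \<iota> x * \<iota> y) \<and> (\<forall>x u. \<iota> x * u = u * \<iota> x)"

context
  fixes \<iota> :: "'c::{comm_ring_1,inverse} \<Rightarrow> 'r::ring_1" and s :: 'c
begin

definition AA_lhs :: "('r, 'n) mat1 \<Rightarrow> ('r, 'n::{finite,linorder}) mat2" where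
  "AA_lhs A = map_matrix \<iota> (qR s) ** leg1 A ** map_matrix \<iota> (transp1 (qR s)) ** leg2 A"

definition AA_rhs :: "('r, 'n) mat1 \<Rightarrow> ('r, 'n::{finite,linorder}) mat2" where
  "AA_rhs A = leg2 A ** map_matrix \<iota> (transp1 (qR s)) ** leg1 A ** map_matrix \<iota> (qR s)"

definition BB_lhs :: "('r, 'n) mat1 \<Rightarrow> ('r, 'n::{finite,linorder}) mat2" where
  "BB_lhs B = map_matrix \<iota> (qR s) ** leg1 B ** leg2 B"

definition BB_rhs :: "('r, 'n) mat1 \<Rightarrow> ('r, 'n::{finite,linorder}) mat2" where
  "BB_rhs B = leg2 B ** leg1 B ** map_matrix \<iota> (qR s)"

definition AB_lhs :: "('r, 'n) mat1 \<Rightarrow> ('r, 'n) mat1 \<Rightarrow> ('r, 'n::{finite,linorder}) mat2" where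
  "AB_lhs A B = leg2 A ** leg1 B ** map_matrix \<iota> (qR s)"

definition AB_rhs :: "('r, 'n) mat1 \<Rightarrow> ('r, 'n) mat1 \<Rightarrow> ('r, 'n::{finite,linorder}) mat2" where
  "AB_rhs A B = leg1 B ** map_matrix \<iota> (transp2 (qR (inverse s))) ** leg2 A"

definition quantum_relations :: "('r, 'n::{finite,linorder}) mat1 \<Rightarrow> ('r, 'n) mat1 \<Rightarrow> bool" where
  "quantum_relations A B \<longleftrightarrow>
     AA_lhs A = AA_rhs A \<and> BB_lhs B = BB_rhs B \<and> AB_lhs A B = AB_rhs A B"

end

subsection \<open>The Jacobi relations\<close>

text \<open>
  Modulo the relations, the two ways of reversing a triple product agree trivially. The
  Jacobi relations are a statement about the reordering rules, so they live in the free
  algebra on the symbols \<open>a\<^sub>i\<^sub>j\<close> and \<open>b\<^sub>i\<^sub>j\<close>: finitely supported functions on words, with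
  the convolution product induced by concatenation.
\<close>

datatype 'g free_word = Word (letters: "'g list")

instantiation free_word :: (type) monoid_add
begin

definition zero_free_word :: "'a free_word" where
  "0 = Word []"

definition plus_free_word :: "'a free_word \<Rightarrow> 'a free_word \<Rightarrow> 'a free_word" where
  "u + v = Word (letters u @ letters v)"

instance
  by standard (simp_all add: zero_free_word_def plus_free_word_def)

end

type_synonym ('g, 'k) free_alg = "'g free_word \<Rightarrow>\<^sub>0 'k"

definition scalar :: "'k::comm_ring_1 \<Rightarrow> ('g, 'k) free_alg" where
  "scalar c = Poly_Mapping.single 0 c"

definition monomial :: "'g list \<Rightarrow> ('g, 'k::comm_ring_1) free_alg" where
  "monomial gs = Poly_Mapping.single (Word gs) 1"

datatype 'n gen = GenA 'n 'n | GenB 'n 'n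

definition genA :: "(('n::finite gen, 'k::comm_ring_1) free_alg, 'n) mat1" where
  "genA = (\<chi> i j. monomial [GenA i j])"

definition genB :: "(('n::finite gen, 'k::comm_ring_1) free_alg, 'n) mat1" where
  "genB = (\<chi> i j. monomial [GenB i j])"

text \<open>
  A reordering rule \<open>\<tau>\<close> replaces a product of two symbols \<open>x y\<close> by an element \<open>\<tau> x y\<close>.
  \<open>reorder_at n \<tau>\<close> is the linear extension of the application of \<open>\<tau>\<close> to the letters in
  positions \<open>n\<close> and \<open>n + 1\<close> (counted from 0); it is only applied to elements whose words
  have at least \<open>n + 2\<close> letters.
\<close>

definition reorder_at ::
    "nat \<Rightarrow> ('g \<Rightarrow> 'g \<Rightarrow> ('g, 'k::comm_ring_1) free_alg) \<Rightarrow> ('g, 'k) free_alg \<Rightarrow> ('g, 'k) free_alg"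
  where
  "reorder_at n \<tau> p = (\<Sum>w\<in>Poly_Mapping.keys p. scalar (Poly_Mapping.lookup p w) *
     monomial (take n (letters w)) * \<tau> (letters w ! n) (letters w ! (n + 1)) *
     monomial (drop (n + 2) (letters w)))"

text \<open>
  The rule prescribed by the quantum relations: each relation equates products in one order
  with products in the other order, and is read entrywise as a rewriting. The mixed relation
  is read in both directions, to reorder \<open>a b\<close> as well as \<open>b a\<close>. Reading the \<open>AA\<close> and \<open>BB\<close>
  relations from right to left instead gives the inverse rule, with the same triple
  consistency conditions.
\<close>

definition reordering_rule ::
    "'k::field \<Rightarrow> ('n gen \<Rightarrow> 'n gen \<Rightarrow> ('n::{finite,linorder} gen, 'k) free_alg) \<Rightarrow> bool" where
  "reordering_rule s \<tau> \<longleftrightarrow>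
     map_matrix (reorder_at 0 \<tau>) (AA_lhs scalar s genA) = AA_rhs scalar s genA \<and>
     map_matrix (reorder_at 0 \<tau>) (BB_lhs scalar s genB) = BB_rhs scalar s genB \<and>
     map_matrix (reorder_at 0 \<tau>) (AB_lhs scalar s genA genB) = AB_rhs scalar s genA genB \<and>
     map_matrix (reorder_at 0 \<tau>) (AB_rhs scalar s genA genB) = AB_lhs scalar s genA genB"

text \<open>
  The symbols \<open>x\<close>, \<open>y\<close>, \<open>z\<close> run over all \<open>a\<^sub>i\<^sub>j\<close> and \<open>b\<^sub>i\<^sub>j\<close>, so the products \<open>x y z\<close> are the
  entries of all the triple products of the matrices in the spaces 1, 2, 3.
\<close>

definition triple_consistent :: "('g \<Rightarrow> 'g \<Rightarrow> ('g, 'k::comm_ring_1) free_alg) \<Rightarrow> bool" where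
  "triple_consistent \<tau> \<longleftrightarrow> (\<forall>x y z.
     reorder_at 0 \<tau> (reorder_at 1 \<tau> (reorder_at 0 \<tau> (monomial [x, y, z]))) =
     reorder_at 1 \<tau> (reorder_at 0 \<tau> (reorder_at 1 \<tau> (monomial [x, y, z]))))"

text \<open>
  The rule is required to be well defined by the relations. The \<open>itself\<close> argument only fixes
  the index type, i.e. \<open>N\<close>.
\<close>

definition jacobi_relations :: "'n::{finite,linorder} itself \<Rightarrow> 'k::field \<Rightarrow> bool" where
  "jacobi_relations _ s \<longleftrightarrow>
     (\<exists>!\<tau> :: 'n gen \<Rightarrow> 'n gen \<Rightarrow> ('n gen, 'k) free_alg. reordering_rule s \<tau>) \<and>
     (\<forall>\<tau> :: 'n gen \<Rightarrow> 'n gen \<Rightarrow> ('n gen, 'k) free_alg.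
        reordering_rule s \<tau> \<longrightarrow> triple_consistent \<tau>)"

subsection \<open>The Poisson algebra and the semiclassical limit\<close>

definition rmat :: "('a::ring_1, 'n::{finite,linorder}) mat2" where
  "rmat = (\<Sum>i\<in>UNIV. tensor (mat_unit i i) (mat_unit i i)) +
     map_matrix ((*) 2) (\<Sum>(i, j)\<in>{(i, j). i > j}. tensor (mat_unit i j) (mat_unit j i))"

text \<open>
  The right-hand sides of the Poisson brackets. They are evaluated on noncommuting
  operators only modulo terms that vanish in the limit, where the order of the factors is
  irrelevant.
\<close>

definition bracket_AA :: "('a::ring_1, 'n) mat1 \<Rightarrow> ('a, 'n::{finite,linorder}) mat2" where
  "bracket_AA A = rmat ** leg1 A ** leg2 A - leg1 A ** leg2 A ** rmat
     + leg1 A ** transp1 rmat ** leg2 A - leg2 A ** transp1 rmat ** leg1 A"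

definition bracket_BB :: "('a::ring_1, 'n) mat1 \<Rightarrow> ('a, 'n::{finite,linorder}) mat2" where
  "bracket_BB B = rmat ** leg1 B ** leg2 B - leg1 B ** leg2 B ** rmat"

definition bracket_BA :: "('a::ring_1, 'n) mat1 \<Rightarrow> ('a, 'n) mat1 \<Rightarrow> ('a, 'n::{finite,linorder}) mat2" where
  "bracket_BA B A = - (leg1 B ** transp2 rmat ** leg2 A) - leg1 B ** leg2 A ** rmat"

text \<open>
  The entries of \<open>leg1 X ** leg2 Y - leg2 Y ** leg1 X\<close> are the commutators of the entries of
  \<open>X\<close> and \<open>Y\<close>. The predicate says \<open>[X, Y] = h P + O(h\<^sup>2)\<close>.
\<close>

definition commutator_limit ::
    "'a::ring_1 \<Rightarrow> ('a, 'n) mat1 \<Rightarrow> ('a, 'n) mat1 \<Rightarrow> ('a, 'n::finite) mat2 \<Rightarrow> bool" where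
  "commutator_limit h X Y P \<longleftrightarrow>
     (\<exists>C. leg1 X ** leg2 Y - leg2 Y ** leg1 X = map_matrix ((*) h) P + map_matrix ((*) (h\<^sup>2)) C)"

definition reindex :: "('n::finite \<Rightarrow> 'n) \<Rightarrow> ('a, 'n) mat1 \<Rightarrow> ('a, 'n) mat1" where
  "reindex w X = (\<chi> i j. X $ w i $ w j)"

text \<open>
  Semiclassical limit for \<open>q = exp (- h)\<close>, in an algebra over the formal power series in \<open>h\<close>.
  With the given conventions, \<open>R\<^sub>1\<^sub>2(q)\<close> has its off-diagonal terms \<open>E\<^sub>k\<^sub>l \<otimes> E\<^sub>l\<^sub>k\<close> at \<open>k < l\<close>, while
  \<open>r\<^sub>1\<^sub>2\<close> has them at \<open>k > l\<close>. The limits of the quantum relations are therefore the Poisson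
  brackets after the matrix indices are renumbered in the opposite order, by \<open>w\<close>.
\<close>

definition semiclassical_limit ::
    "('k::field_char_0 fps \<Rightarrow> 'a::ring_1) \<Rightarrow> ('n::{finite,linorder} \<Rightarrow> 'n) \<Rightarrow>
     ('a, 'n) mat1 \<Rightarrow> ('a, 'n) mat1 \<Rightarrow> bool" where
  "semiclassical_limit \<iota> w A B \<longleftrightarrow>
     (let h = \<iota> fps_X; A' = reindex w A; B' = reindex w B in
        commutator_limit h A' A' (bracket_AA A') \<and>
        commutator_limit h B' B' (bracket_BB B') \<and>
        commutator_limit h B' A' (bracket_BA B' A'))"

end

theory Submission
  imports Defs
begin

text \<open>
  Jacobi relations: view a symbol \<open>a\<^sub>i\<^sub>j\<close> or \<open>b\<^sub>i\<^sub>j\<close> as a cable of two strands carrying its indices. Written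
  out in indices, each relation says that exchanging two symbols is the composition of the four
  crossings of their strands, each of them \<open>R\<^sub>2\<^sub>1(q)\<close>, \<open>R\<^sub>1\<^sub>2(q)\<^sup>-\<^sup>1\<close> or trivial. These are invertible, so the
  reordering rule exists and is unique, and its consistency on triples is the Yang--Baxter equation
  for cables, which follows from the one for single strands.

  Automorphism: partial transpositions of the relations and the exchange of the two spaces give the
  commutation rules for \<open>B\<^sup>T\<close>. Since \<open>R\<^sub>1\<^sub>2\<^bsup>t\<^sub>1\<^esup>\<close> and \<open>R\<^sub>1\<^sub>2\<^bsup>t\<^sub>2\<^esup>\<close> act on the span of the \<open>e\<^sub>i \<otimes> e\<^sub>i\<close> and trivially on its
  complement, they commute with \<open>R\<^sub>1\<^sub>2\<close> and \<open>R\<^sub>2\<^sub>1\<close>, and \<open>B\<close>, \<open>B\<^sup>T\<close> can be moved past \<open>A\<close> on both sides.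

  Semiclassical limit: compare the terms of first order in \<open>h\<close> in \<open>R\<^sub>1\<^sub>2(e\<^sup>-\<^sup>h) = 1 - h r\<^sub>1\<^sub>2 + O(h\<^sup>2)\<close>,
  valid up to reversing the order of the indices.
\<close>

subsection \<open>Crossings\<close>

datatype crossing = Over | Under | Virtual

fun inverse_crossing :: "crossing \<Rightarrow> crossing" where
  "inverse_crossing Over = Under"
| "inverse_crossing Under = Over"
| "inverse_crossing Virtual = Virtual"

text \<open>
  The condition on \<open>e\<^sub>1, e\<^sub>2, e\<^sub>3\<close> for
  \<open>R\<^sub>1\<^sub>2\<^bsup>e\<^sub>1\<^esup> R\<^sub>1\<^sub>3\<^bsup>e\<^sub>2\<^esup> R\<^sub>2\<^sub>3\<^bsup>e\<^sub>3\<^esup> = R\<^sub>2\<^sub>3\<^bsup>e\<^sub>3\<^esup> R\<^sub>1\<^sub>3\<^bsup>e\<^sub>2\<^esup> R\<^sub>1\<^sub>2\<^bsup>e\<^sub>1\<^esup>\<close>. Over and under crossings are mutually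
  inverse braidings, and a triple \<open>e, e\<^sup>-\<^sup>1, e\<close> is not a Reidemeister III configuration.
\<close>

definition consistent_crossings :: "crossing \<Rightarrow> crossing \<Rightarrow> crossing \<Rightarrow> bool" where
  "consistent_crossings e\<^sub>1 e\<^sub>2 e\<^sub>3 \<longleftrightarrow>
     (e\<^sub>1 = Virtual \<and> e\<^sub>2 = Virtual) \<or> (e\<^sub>1 = Virtual \<and> e\<^sub>3 = Virtual) \<or>
     (e\<^sub>2 = Virtual \<and> e\<^sub>3 = Virtual) \<or>
     (e\<^sub>1 \<noteq> Virtual \<and> e\<^sub>2 \<noteq> Virtual \<and> e\<^sub>3 \<noteq> Virtual \<and> \<not> (e\<^sub>1 = e\<^sub>3 \<and> e\<^sub>2 \<noteq> e\<^sub>1))"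

text \<open>
  With \<open>p = q\<close> and \<open>p' = q\<^sup>-\<^sup>1\<close>, the operators \<open>R\<^sub>2\<^sub>1(q)\<close>, \<open>R\<^sub>1\<^sub>2(q)\<^sup>-\<^sup>1\<close> and the identity on functions of two
  indices. Since \<open>R\<close> mixes \<open>(i, j)\<close> only with \<open>(j, i)\<close>, no sums over indices occur.
\<close>

fun cross :: "'r::ring_1 \<Rightarrow> 'r \<Rightarrow> crossing \<Rightarrow> ('n::linorder \<Rightarrow> 'n \<Rightarrow> 'r) \<Rightarrow> 'n \<Rightarrow> 'n \<Rightarrow> 'r" where
  "cross p p' Over f i j =
     (if i = j then p * f i j else f i j + (if j < i then (p - p') * f j i else 0))"
| "cross p p' Under f i j =
     (if i = j then p' * f i j else f i j + (if i < j then (p' - p) * f j i else 0))"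
| "cross p p' Virtual f i j = f i j"

text \<open>The indices of all strands are kept in one assignment \<open>v\<close> of slots, so that
  a crossing can act on any two strands of a longer word.\<close>

definition slot_cross ::
    "'r::ring_1 \<Rightarrow> 'r \<Rightarrow> crossing \<Rightarrow> nat \<Rightarrow> nat \<Rightarrow> ((nat \<Rightarrow> 'n::linorder) \<Rightarrow> 'r) \<Rightarrow> (nat \<Rightarrow> 'n) \<Rightarrow> 'r"
  where
  "slot_cross p p' e a b F v = cross p p' e (\<lambda>i j. F (v(a := i, b := j))) (v a) (v b)"

locale unit_pair =
  fixes p p' :: "'r::ring_1"
  assumes pp' [simp]: "p * p' = 1" and p'p [simp]: "p' * p = 1"
begin

lemma pp'_assoc [simp]: "p * (p' * x) = x" "p' * (p * x) = x"
  by (simp_all flip: mult.assoc)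

text \<open>The inner crossing lists the two strands in the opposite order, which turns R_12^{-1}
  into R_21^{-1}, the inverse of the \<open>Over\<close> crossing R_21.\<close>

lemma cross_inverse:
  "cross p p' e (\<lambda>i j. cross p p' (inverse_crossing e) (\<lambda>j i. f i j) j i) i j = f i j"
  by (cases e) (auto simp: algebra_simps)

text \<open>Both sides involve \<open>f\<close> only at permutations of \<open>(i, j, k)\<close>.
  Once the relative order of the indices is fixed, the identity compares finitely many coefficients
  in \<open>p\<close> and \<open>p'\<close>.\<close>

lemma cross_yang_baxter:
  assumes "consistent_crossings e\<^sub>1 e\<^sub>2 e\<^sub>3"
  shows "cross p p' e\<^sub>1 (\<lambda>i j. cross p p' e\<^sub>2 (\<lambda>i k. cross p p' e\<^sub>3 (\<lambda>j k. f i j k) j k) i k) i j =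
    cross p p' e\<^sub>3 (\<lambda>j k. cross p p' e\<^sub>2 (\<lambda>i k. cross p p' e\<^sub>1 (\<lambda>i j. f i j k) i j) i k) j k"
proof -
  \<comment> \<open>Trichotomy with every consequence of each comparison spelled out, so that
    \<open>simp\<close> decides all conditionals; \<open>order\<close> discards the impossible
    combinations of the three comparisons.\<close>
  have total: thesis
    if "x < y \<Longrightarrow> x \<noteq> y \<Longrightarrow> y \<noteq> x \<Longrightarrow> \<not> y < x \<Longrightarrow> thesis" "x = y \<Longrightarrow> thesis"
      "y < x \<Longrightarrow> x \<noteq> y \<Longrightarrow> y \<noteq> x \<Longrightarrow> \<not> x < y \<Longrightarrow> thesis"
    for x y :: 'a and thesis
    using that by (metis less_imp_not_less neq_iff)
  show ?thesis
    by (insert assms[unfolded consistent_crossings_def];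
        rule total[of i j]; rule total[of j k]; rule total[of i k];
        (order | (cases e\<^sub>1; cases e\<^sub>2; cases e\<^sub>3; simp; simp add: algebra_simps)))
qed

text \<open>The crossings act on disjoint pairs of indices, and their coefficients are polynomials
  in the mutually inverse \<open>p\<close> and \<open>p'\<close>, which commute.\<close>

lemma cross_commute:
  "cross p p' e (\<lambda>i j. cross p p' e' (\<lambda>k l. f i j k l) k l) i j =
   cross p p' e' (\<lambda>k l. cross p p' e (\<lambda>i j. f i j k l) i j) k l"
  by (cases e; cases e') (simp_all add: algebra_simps)

lemma slot_cross_commute:
  fixes F :: "(nat \<Rightarrow> 'n::linorder) \<Rightarrow> 'r"
  assumes "a \<noteq> b" "c \<noteq> d" "a \<noteq> c" "a \<noteq> d" "b \<noteq> c" "b \<noteq> d"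
  shows "slot_cross p p' e a b (slot_cross p p' e' c d F) = slot_cross p p' e' c d (slot_cross p p' e a b F)"
proof
  fix v :: "nat \<Rightarrow> 'n"
  have 1: "v(c := k, d := l, a := i, b := j) = v(a := i, b := j, c := k, d := l)" for i j k l
    using assms by (auto simp: fun_eq_iff)
  show "slot_cross p p' e a b (slot_cross p p' e' c d F) v = slot_cross p p' e' c d (slot_cross p p' e a b F) v"
    using assms cross_commute[of e e' "\<lambda>i j k l. F (v(a := i, b := j, c := k, d := l))"]
    by (simp add: slot_cross_def 1)
qed

lemma slot_cross_yang_baxter:
  fixes F :: "(nat \<Rightarrow> 'n::linorder) \<Rightarrow> 'r"
  assumes "consistent_crossings e\<^sub>1 e\<^sub>2 e\<^sub>3" "a \<noteq> b" "a \<noteq> c" "b \<noteq> c"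
  shows "slot_cross p p' e\<^sub>1 a b (slot_cross p p' e\<^sub>2 a c (slot_cross p p' e\<^sub>3 b c F)) =
    slot_cross p p' e\<^sub>3 b c (slot_cross p p' e\<^sub>2 a c (slot_cross p p' e\<^sub>1 a b F))"
proof
  fix v :: "nat \<Rightarrow> 'n"
  let ?f = "\<lambda>i j k. F (v(a := i, b := j, c := k))"
  \<comment> \<open>\<open>L\<close> and \<open>R\<close> collapse the nested updates of the two
    sides to one normal form, a function of three indices.\<close>
  have L: "v(a := i, b := j, a := i', c := k, b := j', c := k') = v(a := i', b := j', c := k')"
    and R: "v(b := j, c := k, a := i, c := k', a := i', b := j') = v(a := i', b := j', c := k')"
    for i j k i' j' k'
    using assms by (auto simp: fun_eq_iff)
  have "slot_cross p p' e\<^sub>1 a b (slot_cross p p' e\<^sub>2 a c (slot_cross p p' e\<^sub>3 b c F)) v =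
    cross p p' e\<^sub>1 (\<lambda>i j. cross p p' e\<^sub>2 (\<lambda>i k. cross p p' e\<^sub>3 (\<lambda>j k. ?f i j k) j k) i (v c)) (v a) (v b)"
    using assms by (simp only: slot_cross_def L fun_upd_apply if_True if_False simp_thms not_sym)
  moreover have "slot_cross p p' e\<^sub>3 b c (slot_cross p p' e\<^sub>2 a c (slot_cross p p' e\<^sub>1 a b F)) v =
    cross p p' e\<^sub>3 (\<lambda>j k. cross p p' e\<^sub>2 (\<lambda>i k. cross p p' e\<^sub>1 (\<lambda>i j. ?f i j k) i j) (v a) k) (v b) (v c)"
    using assms by (simp only: slot_cross_def R fun_upd_apply if_True if_False simp_thms not_sym)
  ultimately show "slot_cross p p' e\<^sub>1 a b (slot_cross p p' e\<^sub>2 a c (slot_cross p p' e\<^sub>3 b c F)) v =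
    slot_cross p p' e\<^sub>3 b c (slot_cross p p' e\<^sub>2 a c (slot_cross p p' e\<^sub>1 a b F)) v"
    using cross_yang_baxter[OF assms(1), of ?f] by simp
qed

end

subsection \<open>Cables of strands\<close>

datatype kind = A_kind | B_kind

datatype side = Left_side | Right_side

text \<open>
  The table is read off from the quantum relations. The row index of a symbol is its left strand, the
  column index its right strand. In \<open>R\<^sub>1\<^sub>2\<^bsup>t\<^sub>1\<^esup>\<close> between \<open>X\<close> in space 1 and \<open>Y\<close> in space 2 the column index of
  \<open>X\<close> meets the row index of \<open>Y\<close>, so that \<open>R\<^sub>1\<^sub>2\<close> itself acts on these two indices, and similarly for \<open>t\<^sub>2\<close>.
\<close>

fun strand_crossing :: "kind \<times> side \<Rightarrow> kind \<times> side \<Rightarrow> crossing" where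
  "strand_crossing (A_kind, _) (A_kind, Left_side) = Under"
| "strand_crossing (A_kind, _) (A_kind, Right_side) = Over"
| "strand_crossing (A_kind, _) (B_kind, Right_side) = Under"
| "strand_crossing (B_kind, Right_side) (A_kind, _) = Over"
| "strand_crossing (B_kind, Left_side) (B_kind, Left_side) = Under"
| "strand_crossing (B_kind, Right_side) (B_kind, Right_side) = Over"
| "strand_crossing _ _ = Virtual"

text \<open>A finite check over the 64 triples of strand types. Here the powers of R in the three
  quantum relations have to fit together.\<close>

lemma consistent_strand_crossings:
  "consistent_crossings (strand_crossing x y) (strand_crossing x z) (strand_crossing y z)"
proof -
  obtain c s c' s' c'' s'' where "x = (c, s)" "y = (c', s')" "z = (c'', s'')"
    by (cases x; cases y; cases z) auto
  then show ?thesis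
    by (cases c; cases s; cases c'; cases s'; cases c''; cases s'')
       (simp_all add: consistent_crossings_def)
qed

definition strand_cross ::
    "'r::ring_1 \<Rightarrow> 'r \<Rightarrow> (nat \<Rightarrow> kind \<times> side) \<Rightarrow> nat \<Rightarrow> nat \<Rightarrow>
     ((nat \<Rightarrow> 'n::linorder) \<Rightarrow> 'r) \<Rightarrow> (nat \<Rightarrow> 'n) \<Rightarrow> 'r" where
  "strand_cross p p' t a b = slot_cross p p' (strand_crossing (t a) (t b)) a b"

text \<open>The order is that of the braid diagram: the neighbouring strands \<open>a'\<close> and
  \<open>b\<close> meet in the outermost operator, the most distant ones \<open>a\<close> and
  \<open>b'\<close> in the innermost.\<close>

definition cable_cross ::
    "'r::ring_1 \<Rightarrow> 'r \<Rightarrow> (nat \<Rightarrow> kind \<times> side) \<Rightarrow> nat \<Rightarrow> nat \<Rightarrow> nat \<Rightarrow> nat \<Rightarrow>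
     ((nat \<Rightarrow> 'n::linorder) \<Rightarrow> 'r) \<Rightarrow> (nat \<Rightarrow> 'n) \<Rightarrow> 'r" where
  "cable_cross p p' t a a' b b' F =
     strand_cross p p' t a' b (strand_cross p p' t a b
       (strand_cross p p' t a' b' (strand_cross p p' t a b' F)))"

text \<open>
  The solution of a quantum relation for a product of two symbols \<open>c\<^sub>i\<^sub>j d\<^sub>k\<^sub>l\<close>, where \<open>f i j k l\<close> stands for
  \<open>d\<^sub>k\<^sub>l c\<^sub>i\<^sub>j\<close>.
\<close>

definition exchange ::
    "'r::ring_1 \<Rightarrow> 'r \<Rightarrow> kind \<Rightarrow> kind \<Rightarrow> ('n::linorder \<Rightarrow> 'n \<Rightarrow> 'n \<Rightarrow> 'n \<Rightarrow> 'r) \<Rightarrow>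
     'n \<Rightarrow> 'n \<Rightarrow> 'n \<Rightarrow> 'n \<Rightarrow> 'r" where
  "exchange p p' c d f i j k l =
     cross p p' (strand_crossing (c, Right_side) (d, Left_side)) (\<lambda>j k.
     cross p p' (strand_crossing (c, Left_side) (d, Left_side)) (\<lambda>i k.
     cross p p' (strand_crossing (c, Right_side) (d, Right_side)) (\<lambda>j l.
     cross p p' (strand_crossing (c, Left_side) (d, Right_side)) (\<lambda>i l. f i j k l) i l) j l) i k) j k"

context unit_pair
begin

text \<open>Each strand of the first pair is moved through the crossing of the other two pairs separately.\<close>

lemma cable_cross_yang_baxter:
  fixes F :: "(nat \<Rightarrow> 'n::linorder) \<Rightarrow> 'r"
  assumes "distinct [a, a', b, b', c, c']"
  shows "cable_cross p p' t a a' b b' (cable_cross p p' t a a' c c' (cable_cross p p' t b b' c c' F)) =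
    cable_cross p p' t b b' c c' (cable_cross p p' t a a' c c' (cable_cross p p' t a a' b b' F))"
proof -
  let ?Y = "strand_cross p p' t :: nat \<Rightarrow> nat \<Rightarrow> ((nat \<Rightarrow> 'n) \<Rightarrow> 'r) \<Rightarrow> (nat \<Rightarrow> 'n) \<Rightarrow> 'r"
  let ?D = "\<lambda>x F. ?Y a' x (?Y a x F)"
  have YB: "?Y x y (?Y x z (?Y y z F)) = ?Y y z (?Y x z (?Y x y F))" if "distinct [x, y, z]" for x y z F
    using that by (auto simp: strand_cross_def intro!: slot_cross_yang_baxter consistent_strand_crossings)
  have C: "?Y x y (?Y z w F) = ?Y z w (?Y x y F)" if "distinct [x, y, z, w]" for x y z w F
    using that unfolding strand_cross_def by (intro slot_cross_commute) auto
  \<comment> \<open>Yang-Baxter for one cable and two single strands: it is applied once with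
    \<open>a\<close> and once with \<open>a'\<close>, and the remaining crossings are
    disjoint.\<close>
  have D: "?D x (?D y (?Y x y F)) = ?Y x y (?D y (?D x F))" if "distinct [a, a', x, y]" for x y F
  proof -
    have "?D x (?D y (?Y x y F)) = ?Y a' x (?Y a' y (?Y a x (?Y a y (?Y x y F))))"
      using that by (subst C[of a x a' y]) auto
    also have "\<dots> = ?Y a' x (?Y a' y (?Y x y (?Y a y (?Y a x F))))"
      using that by (subst YB[of a x y]) auto
    also have "\<dots> = ?Y x y (?Y a' y (?Y a' x (?Y a y (?Y a x F))))"
      using that by (subst YB[of a' x y]) auto
    also have "\<dots> = ?Y x y (?D y (?D x F))"
      using that by (subst C[of a' x a y]) auto
    finally show ?thesis .
  qed
  have CD: "?D x (?Y y z F) = ?Y y z (?D x F)" if "distinct [a, a', x, y, z]" for x y z F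
  proof -
    have "?D x (?Y y z F) = ?Y a' x (?Y y z (?Y a x F))"
      using that by (subst C[of a x y z]) auto
    also have "\<dots> = ?Y y z (?D x F)"
      using that by (subst C[of a' x y z]) auto
    finally show ?thesis .
  qed
  have dist: "distinct [a, a', b, c]" "distinct [a, a', b, c']" "distinct [a, a', b', c]"
    "distinct [a, a', b', c']" "distinct [a, a', c', b', c]" "distinct [a, a', b, b', c]"
    "distinct [a, a', c, b', c']" "distinct [a, a', c', b, c]" "distinct [a, a', b', b, c]"
    "distinct [a, a', b, b', c']" "distinct [a, a', c, b, c']" "distinct [a, a', b', b, c']"
    using assms by auto
  \<comment> \<open>The crossings of the pairs (b', c), (b, c), (b', c'), (b, c') are pulled out to
    the left in this order.\<close>
  have "cable_cross p p' t a a' b b' (cable_cross p p' t a a' c c' (cable_cross p p' t b b' c c' F)) =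
    ?D b (?D b' (?D c (?D c' (?Y b' c (?Y b c (?Y b' c' (?Y b c' F)))))))"
    by (simp add: cable_cross_def)
  also have "\<dots> = ?Y b' c (?D b (?D c (?D b' (?D c' (?Y b c (?Y b' c' (?Y b c' F)))))))"
    by (simp only: CD[OF dist(5)] D[OF dist(3)] CD[OF dist(6)])
  also have "\<dots> = ?Y b' c (?D b (?D c (?Y b c (?D b' (?D c' (?Y b' c' (?Y b c' F)))))))"
    by (simp only: CD[OF dist(8)] CD[OF dist(9)])
  also have "\<dots> = ?Y b' c (?Y b c (?D c (?D b (?Y b' c' (?D c' (?D b' (?Y b c' F)))))))"
    by (simp only: D[OF dist(1)] D[OF dist(4)])
  also have "\<dots> = ?Y b' c (?Y b c (?Y b' c' (?D c (?D b (?D c' (?Y b c' (?D b' F)))))))"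
    by (simp only: CD[OF dist(10)] CD[OF dist(7)] CD[OF dist(12)])
  also have "\<dots> = ?Y b' c (?Y b c (?Y b' c' (?Y b c' (?D c (?D c' (?D b (?D b' F)))))))"
    by (simp only: D[OF dist(2)] CD[OF dist(11)])
  finally show ?thesis
    by (simp add: cable_cross_def)
qed

text \<open>A crossing is a combination with left coefficients built from \<open>p\<close> and
  \<open>p'\<close>. The maps \<open>f\<close> to be moved inside are reorderings and
  multiplications by letters.\<close>

lemma cross_hom:
  assumes "\<And>x y. f (x + y) = f x + f y" "\<And>x. f (p * x) = p * f x" "\<And>x. f (p' * x) = p' * f x"
  shows "f (cross p p' e F i j) = cross p p' e (\<lambda>i j. f (F i j)) i j"
proof -
  have diff: "f (x - y) = f x - f y" for x y
    using assms(1)[of "x - y" y] by simp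
  have zero: "f 0 = 0"
    using assms(1)[of 0 0] by simp
  show ?thesis
    by (cases e) (simp_all add: left_diff_distrib assms diff zero)
qed

lemma cable_cross_hom:
  assumes "\<And>x y. f (x + y) = f x + f y" "\<And>x. f (p * x) = p * f x" "\<And>x. f (p' * x) = p' * f x"
  shows "f (cable_cross p p' t a a' b b' F v) = cable_cross p p' t a a' b b' (\<lambda>v. f (F v)) v"
  unfolding cable_cross_def strand_cross_def slot_cross_def by (simp only: cross_hom[OF assms])

lemma exchange_hom:
  assumes "\<And>x y. f (x + y) = f x + f y" "\<And>x. f (p * x) = p * f x" "\<And>x. f (p' * x) = p' * f x"
  shows "f (exchange p p' c d F i j k l) = exchange p p' c d (\<lambda>i j k l. f (F i j k l)) i j k l"
  unfolding exchange_def by (simp only: cross_hom[OF assms])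

text \<open>Invertibility of a crossing, in the form that solves an entrywise relation for the
  product in the old order.\<close>

lemma cross_eq_iff:
  "(\<forall>i j. cross p p' e f i j = g i j) \<longleftrightarrow>
   (\<forall>i j. f i j = cross p p' (inverse_crossing e) (\<lambda>j i. g i j) j i)"
proof
  assume "\<forall>i j. cross p p' e f i j = g i j"
  then have "g = (\<lambda>i j. cross p p' e f i j)"
    by (simp add: fun_eq_iff)
  moreover have "inverse_crossing (inverse_crossing e) = e"
    by (cases e) simp_all
  ultimately show "\<forall>i j. f i j = cross p p' (inverse_crossing e) (\<lambda>j i. g i j) j i"
    using cross_inverse[of "inverse_crossing e" "\<lambda>j i. f i j"] by simp
next
  assume "\<forall>i j. f i j = cross p p' (inverse_crossing e) (\<lambda>j i. g i j) j i"
  then have "f = (\<lambda>i j. cross p p' (inverse_crossing e) (\<lambda>j i. g i j) j i)"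
    by (simp add: fun_eq_iff)
  then show "\<forall>i j. cross p p' e f i j = g i j"
    using cross_inverse[of e g] by simp
qed

lemma cross_Over_eq_iff:
  "(\<forall>i j. cross p p' Over f i j = g i j) \<longleftrightarrow> (\<forall>i j. f i j = cross p p' Under (\<lambda>j i. g i j) j i)"
  by (fact cross_eq_iff[of Over, unfolded inverse_crossing.simps])

lemma cross_Under_eq_iff:
  "(\<forall>i j. cross p p' Under f i j = g i j) \<longleftrightarrow> (\<forall>i j. f i j = cross p p' Over (\<lambda>j i. g i j) j i)"
  by (fact cross_eq_iff[of Under, unfolded inverse_crossing.simps])

text \<open>\<open>T\<close> stands for the product in the old order, \<open>G\<close> for the one
  in the new order. The two crossings on the left are inverted one after the other, first in
  \<open>(k, i)\<close> at fixed \<open>j, l\<close>, then in \<open>(k, j)\<close> at fixed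
  \<open>i, l\<close>.\<close>

lemma exchange_AA_iff:
  "(\<forall>i j k l. cross p p' Over (\<lambda>k i. cross p p' Over (\<lambda>k j. T i j k l) k j) k i =
      cross p p' Over (\<lambda>j l. cross p p' Over (\<lambda>i l. G i j k l) i l) j l) \<longleftrightarrow>
   (\<forall>i j k l. T i j k l = exchange p p' A_kind A_kind G i j k l)" (is "?L \<longleftrightarrow> ?R")
proof -
  let ?H = "\<lambda>i k j l. cross p p' Over (\<lambda>j l. cross p p' Over (\<lambda>i l. G i j k l) i l) j l"
  have "?L \<longleftrightarrow> (\<forall>j l. \<forall>k i. cross p p' Over (\<lambda>k i. cross p p' Over (\<lambda>k j. T i j k l) k j) k i = ?H i k j l)"
    by blast
  also have "\<dots> \<longleftrightarrow> (\<forall>j l. \<forall>k i. cross p p' Over (\<lambda>k j. T i j k l) k j =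
      cross p p' Under (\<lambda>i k. ?H i k j l) i k)"
    by (intro cross_Over_eq_iff iff_allI)
  also have "\<dots> \<longleftrightarrow> (\<forall>i l. \<forall>k j. cross p p' Over (\<lambda>k j. T i j k l) k j =
      cross p p' Under (\<lambda>i k. ?H i k j l) i k)"
    by blast
  also have "\<dots> \<longleftrightarrow> (\<forall>i l. \<forall>k j. T i j k l = exchange p p' A_kind A_kind G i j k l)"
    unfolding exchange_def strand_crossing.simps by (intro cross_Over_eq_iff iff_allI)
  finally show ?thesis by blast
qed

lemma exchange_BB_iff:
  "(\<forall>i j k l. cross p p' Over (\<lambda>k i. T i j k l) k i = cross p p' Over (\<lambda>j l. G i j k l) j l) \<longleftrightarrow>
   (\<forall>i j k l. T i j k l = exchange p p' B_kind B_kind G i j k l)" (is "?L \<longleftrightarrow> ?R")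
proof -
  have "?L \<longleftrightarrow> (\<forall>j l. \<forall>k i. cross p p' Over (\<lambda>k i. T i j k l) k i = cross p p' Over (\<lambda>j l. G i j k l) j l)"
    by blast
  also have "\<dots> \<longleftrightarrow> (\<forall>j l. \<forall>k i. T i j k l = exchange p p' B_kind B_kind G i j k l)"
    unfolding exchange_def strand_crossing.simps cross.simps(3) by (intro cross_Over_eq_iff iff_allI)
  finally show ?thesis by blast
qed

lemma exchange_AB_iff:
  "(\<forall>i j k l. cross p p' Over (\<lambda>l j. T i j k l) l j = cross p p' Under (\<lambda>i l. G i j k l) i l) \<longleftrightarrow>
   (\<forall>i j k l. T i j k l = exchange p p' A_kind B_kind G i j k l)" (is "?L \<longleftrightarrow> ?R")
proof -
  have "?L \<longleftrightarrow> (\<forall>i k. \<forall>l j. cross p p' Over (\<lambda>l j. T i j k l) l j = cross p p' Under (\<lambda>i l. G i j k l) i l)"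
    by blast
  also have "\<dots> \<longleftrightarrow> (\<forall>i k. \<forall>l j. T i j k l = exchange p p' A_kind B_kind G i j k l)"
    unfolding exchange_def strand_crossing.simps cross.simps(3) by (intro cross_Over_eq_iff iff_allI)
  finally show ?thesis by blast
qed

lemma exchange_BA_iff:
  "(\<forall>i j k l. cross p p' Under (\<lambda>k j. T i j k l) k j = cross p p' Over (\<lambda>j l. G i j k l) j l) \<longleftrightarrow>
   (\<forall>i j k l. T i j k l = exchange p p' B_kind A_kind G i j k l)" (is "?L \<longleftrightarrow> ?R")
proof -
  have "?L \<longleftrightarrow> (\<forall>i l. \<forall>k j. cross p p' Under (\<lambda>k j. T i j k l) k j = cross p p' Over (\<lambda>j l. G i j k l) j l)"
    by blast
  also have "\<dots> \<longleftrightarrow> (\<forall>i l. \<forall>k j. T i j k l = exchange p p' B_kind A_kind G i j k l)"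
    unfolding exchange_def strand_crossing.simps cross.simps(3) by (intro cross_Under_eq_iff iff_allI)
  finally show ?thesis by blast
qed

text \<open>Connects the formula read off from the relations with the slot form for which the
  Yang-Baxter equation is available.\<close>

lemma cable_cross_eq_exchange:
  fixes F :: "(nat \<Rightarrow> 'n::linorder) \<Rightarrow> 'r"
  assumes "distinct [a, a', b, b']"
    and "t a = (c, Left_side)" "t a' = (c, Right_side)" "t b = (d, Left_side)" "t b' = (d, Right_side)"
  shows "cable_cross p p' t a a' b b' F v =
    exchange p p' c d (\<lambda>i j k l. F (v(a := i, a' := j, b := k, b' := l))) (v a) (v a') (v b) (v b')"
proof -
  have 1: "v(a' := j, b := k, a := i, b := k', a' := j', b' := l, a := i', b' := l') =
     v(a := i', a' := j', b := k', b' := l')" for i j k l i' j' k' l'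
    using assms by (auto simp: fun_eq_iff)
  have 2: "a \<noteq> a'" "a' \<noteq> a" "a \<noteq> b" "b \<noteq> a" "a \<noteq> b'" "b' \<noteq> a" "a' \<noteq> b" "b \<noteq> a'"
    "a' \<noteq> b'" "b' \<noteq> a'" "b \<noteq> b'" "b' \<noteq> b"
    using assms(1) by auto
  show ?thesis
    by (simp only: cable_cross_def strand_cross_def slot_cross_def assms(2-) exchange_def 1 2
      fun_upd_apply if_True if_False simp_thms)
qed

end

subsection \<open>Entries of the quantum relations\<close>

lemma sum_UNIV_prod:
  "(\<Sum>x\<in>UNIV. f x) = (\<Sum>i\<in>UNIV. \<Sum>j\<in>UNIV. f (i :: 'i::finite, j :: 'j::finite))"
  by (simp add: sum.cartesian_product flip: UNIV_Times_UNIV)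

lemma leg1_nth: "leg1 A $ (i, k) $ (j, l) = A $ i $ j * (if k = l then 1 else 0)"
  by (simp add: leg1_def tensor_def mat_def)

lemma leg2_nth: "leg2 A $ (i, k) $ (j, l) = (if i = j then 1 else 0) * A $ k $ l"
  by (simp add: leg2_def tensor_def mat_def)

lemma leg1_mult_nth: "(leg1 A ** M) $ (i, k) $ y = (\<Sum>j\<in>UNIV. A $ i $ j * M $ (j, k) $ y)"
  by (simp add: matrix_matrix_mult_def sum_UNIV_prod leg1_nth if_distrib if_distribR cong: if_cong)

lemma leg2_mult_nth: "(leg2 A ** M) $ (i, k) $ y = (\<Sum>j\<in>UNIV. A $ k $ j * M $ (i, j) $ y)"
proof -
  have "(leg2 A ** M) $ (i, k) $ y = (\<Sum>j\<in>UNIV. \<Sum>l\<in>UNIV. if i = j then A $ k $ l * M $ (j, l) $ y else 0)"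
    by (simp add: matrix_matrix_mult_def sum_UNIV_prod leg2_nth if_distrib if_distribR cong: if_cong)
  also have "\<dots> = (\<Sum>l\<in>UNIV. \<Sum>j\<in>UNIV. if i = j then A $ k $ l * M $ (j, l) $ y else 0)"
    by (rule sum.swap)
  finally show ?thesis by simp
qed

lemma mult_leg1_nth: "(M ** leg1 A) $ x $ (j, l) = (\<Sum>i\<in>UNIV. M $ x $ (i, l) * A $ i $ j)"
  by (simp add: matrix_matrix_mult_def sum_UNIV_prod leg1_nth if_distrib if_distribR cong: if_cong)

lemma mult_leg2_nth: "(M ** leg2 A) $ x $ (j, l) = (\<Sum>k\<in>UNIV. M $ x $ (j, k) * A $ k $ l)"
proof -
  have "(M ** leg2 A) $ x $ (j, l) = (\<Sum>i\<in>UNIV. \<Sum>k\<in>UNIV. if i = j then M $ x $ (i, k) * A $ k $ l else 0)"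
    by (simp add: matrix_matrix_mult_def sum_UNIV_prod leg2_nth if_distrib if_distribR mult.assoc cong: if_cong)
  also have "\<dots> = (\<Sum>k\<in>UNIV. \<Sum>i\<in>UNIV. if i = j then M $ x $ (i, k) * A $ k $ l else 0)"
    by (rule sum.swap)
  finally show ?thesis by simp
qed

lemma transp1_nth [simp]: "transp1 M $ (i, k) $ (j, l) = M $ (j, k) $ (i, l)"
  by (simp add: transp1_def)

lemma transp2_nth [simp]: "transp2 M $ (i, k) $ (j, l) = M $ (i, l) $ (j, k)"
  by (simp add: transp2_def)

text \<open>\<open>R\<^sub>1\<^sub>2(q)\<close> with \<open>p = q\<close> and \<open>p' = q\<^sup>-\<^sup>1\<close>; its inverse is \<open>Rmat p' p\<close>.\<close>

definition Rmat :: "'r::ring_1 \<Rightarrow> 'r \<Rightarrow> ('r, 'n::{finite,linorder}) mat2" where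
  "Rmat p p' = (\<chi> x y. (if y = x then if fst x = snd x then p else 1 else 0) +
     (if y = (snd x, fst x) then if fst x < snd x then p - p' else 0 else 0))"

lemma Rmat_nth:
  "Rmat p p' $ (i, k) $ y = (if y = (i, k) then if i = k then p else 1 else 0) +
     (if y = (k, i) then if i < k then p - p' else 0 else 0)"
  unfolding Rmat_def vec_lambda_beta fst_conv snd_conv ..

text \<open>A row of R has at most two nonzero entries. Since \<open>Over\<close> is R_21,
  multiplication by R_12 from the left is \<open>Over\<close> with the two indices
  exchanged.\<close>

lemma Rmat_sum_right:
  "(\<Sum>x\<in>UNIV. Rmat p p' $ (i, k) $ x * g x) = cross p p' Over (\<lambda>k i. g (i, k)) k i"
proof -
  have "Rmat p p' $ (i, k) $ x * g x = (if x = (i, k) then (if i = k then p else 1) * g x else 0) +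
    (if x = (k, i) then (if i < k then p - p' else 0) * g x else 0)" for x
    unfolding Rmat_nth distrib_right by (intro arg_cong2[where f = "(+)"]) simp_all
  then have "(\<Sum>x\<in>UNIV. Rmat p p' $ (i, k) $ x * g x) =
    (if i = k then p else 1) * g (i, k) + (if i < k then p - p' else 0) * g (k, i)"
    by (simp only: sum.distrib sum.delta finite_class.finite_UNIV UNIV_I if_True)
  then show ?thesis
    by auto
qed

lemma Rmat_nth':
  "Rmat p p' $ x $ (j, l) = (if x = (j, l) then if j = l then p else 1 else 0) +
     (if x = (l, j) then if l < j then p - p' else 0 else 0)"
proof (cases x)
  case (Pair a b)
  show ?thesis
    unfolding Rmat_nth Pair by (intro arg_cong2[where f = "(+)"]) auto
qed

lemma Rmat_central:
  assumes "\<And>x. p * x = x * p" "\<And>x. p' * x = x * p'"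
  shows "Rmat p p' $ x $ y * u = u * Rmat p p' $ x $ y"
proof -
  have "((if P then if Q then p else 1 else 0) + (if P' then if Q' then p - p' else 0 else 0)) * u =
    u * ((if P then if Q then p else 1 else 0) + (if P' then if Q' then p - p' else 0 else 0))" for P Q P' Q'
    using assms[of u] by (simp add: distrib_left distrib_right left_diff_distrib right_diff_distrib)
  then show ?thesis
    by (cases x) (simp only: Rmat_nth)
qed

text \<open>In a column of R the comparison of the indices is reversed, so \<open>Over\<close> takes
  them in their given order. Centrality brings the coefficients to the left of
  \<open>g\<close>.\<close>

lemma Rmat_sum_left:
  assumes "\<And>x. p * x = x * p" "\<And>x. p' * x = x * p'"
  shows "(\<Sum>x\<in>UNIV. g x * Rmat p p' $ x $ (j, l)) = cross p p' Over (\<lambda>j l. g (j, l)) j l"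
proof -
  have "Rmat p p' $ x $ (j, l) * g x = (if x = (j, l) then (if j = l then p else 1) * g x else 0) +
    (if x = (l, j) then (if l < j then p - p' else 0) * g x else 0)" for x
    unfolding Rmat_nth' distrib_right by (intro arg_cong2[where f = "(+)"]) simp_all
  then have "(\<Sum>x\<in>UNIV. g x * Rmat p p' $ x $ (j, l)) =
    (if j = l then p else 1) * g (j, l) + (if l < j then p - p' else 0) * g (l, j)"
    by (simp only: Rmat_central[OF assms, symmetric] sum.distrib sum.delta finite_class.finite_UNIV
        UNIV_I if_True)
  then show ?thesis
    by auto
qed

lemma Rmat_swap_eq_Under: "cross p' p Over (\<lambda>j k. f j k) j k = cross p p' Under (\<lambda>k j. f j k) k j"
  by auto

locale central_unit_pair = unit_pair +
  assumes p_central: "p * x = x * p" and p'_central: "p' * x = x * p'"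
begin

lemmas R_central = Rmat_central[OF p_central p'_central]
lemmas R_sum_left = Rmat_sum_left[OF p_central p'_central]
lemmas R_sum_left' = Rmat_sum_left[OF p'_central p_central]

lemma R_nth_mult: "(Rmat p p' ** M) $ (i, k) $ y = cross p p' Over (\<lambda>k i. M $ (i, k) $ y) k i"
  unfolding matrix_matrix_mult_def by (simp add: Rmat_sum_right)

lemma mult_R_nth: "(M ** Rmat p p') $ x $ (j, l) = cross p p' Over (\<lambda>j l. M $ x $ (j, l)) j l"
  unfolding matrix_matrix_mult_def using R_sum_left[of "\<lambda>y. M $ x $ y"] by simp

text \<open>Between the two factors the transposed R is contracted with a column index of the first
  and a row index of the second; this is a sum over one row of R itself.\<close>

lemma AA_lhs_nth:
  "(Rmat p p' ** leg1 A ** transp1 (Rmat p p') ** leg2 A) $ (i, k) $ (j, l) =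
     cross p p' Over (\<lambda>k i. cross p p' Over (\<lambda>k j. A $ i $ j * A $ k $ l) k j) k i"
proof -
  have "(leg1 A ** (transp1 (Rmat p p') ** leg2 A)) $ (i, k) $ (j, l) =
    (\<Sum>x\<in>UNIV. Rmat p p' $ (j, k) $ x * (A $ i $ fst x * A $ snd x $ l))" for i k
    by (simp add: leg1_mult_nth mult_leg2_nth sum_UNIV_prod sum_distrib_left)
       (simp add: R_central mult.assoc)
  then show ?thesis
    by (simp only: matrix_mul_assoc[symmetric] R_nth_mult Rmat_sum_right fst_conv snd_conv)
qed

lemma AA_rhs_nth:
  "(leg2 A ** transp1 (Rmat p p') ** leg1 A ** Rmat p p') $ (i, k) $ (j, l) =
     cross p p' Over (\<lambda>j l. cross p p' Over (\<lambda>i l. A $ k $ l * A $ i $ j) i l) j l"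
proof -
  have "(leg2 A ** transp1 (Rmat p p') ** leg1 A) $ (i, k) $ (j, l) =
    (\<Sum>x\<in>UNIV. A $ k $ snd x * A $ fst x $ j * Rmat p p' $ x $ (i, l))" for j l
    by (simp add: leg2_mult_nth mult_leg1_nth sum_UNIV_prod sum_distrib_right)
       (simp add: R_central mult.assoc)
  then show ?thesis
    by (simp only: mult_R_nth R_sum_left fst_conv snd_conv)
qed

lemma BB_lhs_nth:
  "(Rmat p p' ** leg1 B ** leg2 B) $ (i, k) $ (j, l) = cross p p' Over (\<lambda>k i. B $ i $ j * B $ k $ l) k i"
proof -
  have "(leg1 B ** leg2 B) $ (i, k) $ (j, l) = B $ i $ j * B $ k $ l" for i k
    by (simp add: mult_leg2_nth leg1_nth if_distrib if_distribR cong: if_cong)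
  then show ?thesis
    by (simp only: matrix_mul_assoc[symmetric] R_nth_mult)
qed

lemma leg2_leg1_R_nth:
  "(leg2 A ** leg1 B ** Rmat p p') $ (i, k) $ (j, l) = cross p p' Over (\<lambda>j l. A $ k $ l * B $ i $ j) j l"
proof -
  have "(leg2 A ** leg1 B) $ (i, k) $ (j, l) = A $ k $ l * B $ i $ j" for j l
    by (simp add: mult_leg1_nth leg2_nth if_distrib if_distribR cong: if_cong)
  then show ?thesis
    by (simp only: mult_R_nth)
qed

lemma AB_rhs_nth:
  "(leg1 B ** transp2 (Rmat p' p) ** leg2 A) $ (i, k) $ (j, l) =
     cross p p' Under (\<lambda>k j. B $ i $ j * A $ k $ l) k j"
proof -
  have "(leg1 B ** transp2 (Rmat p' p) ** leg2 A) $ (i, k) $ (j, l) =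
    (\<Sum>x\<in>UNIV. B $ i $ fst x * A $ snd x $ l * Rmat p' p $ x $ (j, k))"
    by (simp add: leg1_mult_nth mult_leg2_nth sum_UNIV_prod sum_distrib_right matrix_mul_assoc[symmetric])
       (simp add: Rmat_central[OF p'_central p_central] mult.assoc sum_distrib_left)
  then show ?thesis
    by (simp only: R_sum_left' fst_conv snd_conv Rmat_swap_eq_Under)
qed

end

text \<open>The diagonal coefficient is 1 + (q - 1/q)/2 + (s - 1/s)^2/2 = q with q = s^2. The laws
  of division are hypotheses, so that fields and formal power series are covered together.\<close>

lemma qR_eq_Rmat:
  fixes s :: "'c::{comm_ring_1,inverse}"
  assumes "\<And>x :: 'c. x / 2 + x / 2 = x" "s * inverse s = 1" "inverse (s\<^sup>2) = (inverse s)\<^sup>2"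
  shows "(qR s :: ('c, 'n::{finite,linorder}) mat2) = Rmat (s\<^sup>2) (inverse (s\<^sup>2))"
proof -
  have two: "1 / 2 * 2 = (1 :: 'c)"
    using assms(1)[of 1] by (simp only: mult_2_right)
  \<comment> \<open>In this sort division is not tied to multiplication; the first hypothesis
    supplies the link for the divisor 2.\<close>
  have half: "x / 2 = x * (1 / 2)" for x :: 'c
  proof -
    have "x / 2 = x / 2 * (1 / 2 * 2)"
      unfolding two by simp
    also have "\<dots> = (x / 2 + x / 2) * (1 / 2)"
      by (simp only: mult_2_right[symmetric] mult.assoc mult.commute[of 2 "1 / 2"])
    finally show ?thesis
      by (simp only: assms(1))
  qed
  have diag: "(s\<^sup>2 - inverse (s\<^sup>2)) * (1 / 2) + (s - inverse s)\<^sup>2 / 2 = s\<^sup>2 - 1"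
  proof -
    have "(s\<^sup>2 - inverse (s\<^sup>2)) + (s - inverse s)\<^sup>2 = 2 * (s\<^sup>2 - 1)"
    proof -
      have "(x\<^sup>2 - y\<^sup>2) + (x - y)\<^sup>2 = 2 * (x\<^sup>2 - x * y)" for x y :: 'c
        by (simp add: power2_eq_square algebra_simps)
      from this[of s "inverse s"] show ?thesis
        by (simp only: assms(2,3))
    qed
    then have "((s\<^sup>2 - inverse (s\<^sup>2)) + (s - inverse s)\<^sup>2) * (1 / 2) = (s\<^sup>2 - 1) * (1 / 2 * 2)"
      by (simp only: mult.assoc mult.commute mult.left_commute)
    then show ?thesis
      by (simp only: half[of "(s - inverse s)\<^sup>2"] distrib_right two mult_1_right)
  qed
  have sum_delta2: "(\<Sum>a\<in>UNIV. \<Sum>b\<in>UNIV. if a = i then if b = j then f a b else 0 else 0) = f i j"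
    for f :: "'n \<Rightarrow> 'n \<Rightarrow> 'c" and i j
  proof -
    have "(\<Sum>b\<in>UNIV. if a = i then if b = j then f a b else 0 else 0) = (if a = i then f a j else 0)" for a
      by (cases "a = i") simp_all
    then show ?thesis by simp
  qed
  have entry: "qR s $ (i, k) $ (j, l) = Rmat (s\<^sup>2) (inverse (s\<^sup>2)) $ (i, k) $ (j, l)" for i j k l :: 'n
  proof -
    let ?c = "\<lambda>a b :: 'n. (s\<^sup>2 - inverse (s\<^sup>2)) * theta b a + (s - inverse s)\<^sup>2 / 2 * (if a = b then 1 else 0)"
    have "qR s $ (i, k) $ (j, l) = (if i = j \<and> k = l then 1 else 0) +
      (\<Sum>a\<in>UNIV. \<Sum>b\<in>UNIV. if a = i then if b = j then if k = b \<and> l = a then ?c a b else 0 else 0 else 0)"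
      by (auto simp: qR_def tensor_def mat_def mat_unit_def intro!: sum.cong)
    also have "\<dots> = (if i = j \<and> k = l then 1 else 0) + (if k = j \<and> l = i then ?c i j else 0)"
      unfolding sum_delta2 ..
    also have "\<dots> = Rmat (s\<^sup>2) (inverse (s\<^sup>2)) $ (i, k) $ (j, l)"
    proof -
      have c: "?c i j = (if i = j then s\<^sup>2 - 1 else if i < j then s\<^sup>2 - inverse (s\<^sup>2) else 0)"
        using diag by (cases i j rule: linorder_cases) (simp_all add: theta_def less_imp_neq less_not_sym)
      show ?thesis
        unfolding Rmat_nth c prod.inject
        by (cases "i = k"; cases "j = i"; cases "l = k"; cases "j = k"; cases "l = i") simp_all
    qed
    finally show ?thesis .
  qed
  show ?thesis
    by (simp add: vec_eq_iff entry)
qed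

lemma map_matrix_Rmat:
  assumes "algebra_map \<iota>"
  shows "map_matrix \<iota> (Rmat p p') = Rmat (\<iota> p) (\<iota> p')"
    and "map_matrix \<iota> (transp1 (Rmat p p')) = transp1 (Rmat (\<iota> p) (\<iota> p'))"
    and "map_matrix \<iota> (transp2 (Rmat p p')) = transp2 (Rmat (\<iota> p) (\<iota> p'))"
proof -
  have add: "\<iota> (x + y) = \<iota> x + \<iota> y" for x y
    using assms by (simp add: algebra_map_def)
  have one: "\<iota> 1 = 1"
    using assms by (simp add: algebra_map_def)
  have zero: "\<iota> 0 = 0"
    using add[of 0 0] by simp
  have diff: "\<iota> (x - y) = \<iota> x - \<iota> y" for x y
    using add[of "x - y" y] by simp
  show 1: "map_matrix \<iota> (Rmat p p') = Rmat (\<iota> p) (\<iota> p')"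
    by (simp add: vec_eq_iff Rmat_def add one zero diff)
  have 2: "\<iota> (Rmat p p' $ x $ y) = Rmat (\<iota> p) (\<iota> p') $ x $ y" for x y
    using 1 by (metis nth_map_matrix)
  show "map_matrix \<iota> (transp1 (Rmat p p')) = transp1 (Rmat (\<iota> p) (\<iota> p'))"
    "map_matrix \<iota> (transp2 (Rmat p p')) = transp2 (Rmat (\<iota> p) (\<iota> p'))"
    by (simp_all add: vec_eq_iff transp1_def transp2_def 2)
qed

subsection \<open>The Jacobi relations\<close>

lemma scalar_zero [simp]: "scalar 0 = 0"
  by (simp add: scalar_def)

lemma lookup_scalar_mult: "Poly_Mapping.lookup (scalar c * p) w = c * Poly_Mapping.lookup p w"
proof -
  have "scalar c * p = Poly_Mapping.map ((*) c) p"
    by (simp only: scalar_def mult_map_scale_conv_mult)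
  then show ?thesis
    by (simp add: Poly_Mapping.map.rep_eq when_def)
qed

lemma keys_scalar_mult: "Poly_Mapping.keys (scalar c * p) \<subseteq> Poly_Mapping.keys p"
  by (metis in_keys_iff lookup_scalar_mult mult_zero_right subsetI)

lemma lookup_mult_scalar: "Poly_Mapping.lookup (p * scalar c) w = Poly_Mapping.lookup p w * c"
proof -
  have single: "Poly_Mapping.single k a * scalar c = Poly_Mapping.single k (a * c)" for k a
    by (simp add: scalar_def mult_single)
  show ?thesis
  proof (induction p rule: update_induct)
    case (update f a b)
    have "Poly_Mapping.update a b f = Poly_Mapping.single a b + f"
      using update.hyps by (auto intro!: poly_mapping_eqI simp: lookup_update lookup_add lookup_single in_keys_iff)
    then show ?case
      using update.IH by (simp add: distrib_right single lookup_add lookup_single when_def)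
  qed simp
qed

lemma scalar_central: "scalar c * p = p * scalar c"
  by (rule poly_mapping_eqI) (simp add: lookup_scalar_mult lookup_mult_scalar mult.commute)

lemma scalar_left_commute: "p * (scalar c * q) = scalar c * (p * q)"
  by (metis mult.assoc scalar_central)

lemma algebra_map_scalar: "algebra_map (scalar :: 'k::comm_ring_1 \<Rightarrow> ('g, 'k) free_alg)"
  unfolding algebra_map_def using scalar_central
  by (auto simp: scalar_def single_add mult_single)

lemma monomial_mult: "monomial gs * monomial hs = monomial (gs @ hs)"
  by (simp add: monomial_def mult_single plus_free_word_def)

lemma monomial_Nil [simp]: "monomial [] = 1"
  by (simp add: monomial_def flip: zero_free_word_def)

text \<open>A common finite index set makes the sums for \<open>p\<close>, \<open>q\<close> and
  \<open>p + q\<close> comparable term by term.\<close>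

lemma reorder_at_superset:
  assumes "finite S" "Poly_Mapping.keys p \<subseteq> S"
  shows "reorder_at n \<tau> p = (\<Sum>w\<in>S. scalar (Poly_Mapping.lookup p w) *
     monomial (take n (letters w)) * \<tau> (letters w ! n) (letters w ! (n + 1)) *
     monomial (drop (n + 2) (letters w)))"
  unfolding reorder_at_def
  by (rule sum.mono_neutral_left) (use assms in \<open>auto simp: in_keys_iff\<close>)

lemma reorder_at_add: "reorder_at n \<tau> (p + q) = reorder_at n \<tau> p + reorder_at n \<tau> q"
proof -
  let ?S = "Poly_Mapping.keys p \<union> Poly_Mapping.keys q"
  have add: "scalar (a + b) = scalar a + scalar b" for a b
    by (simp add: scalar_def single_add)
  show ?thesis
    using keys_add[of p q]
    by (simp add: reorder_at_superset[of ?S] lookup_add add distrib_right sum.distrib)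
qed

lemma reorder_at_scale: "reorder_at n \<tau> (scalar c * p) = scalar c * reorder_at n \<tau> p"
proof -
  have mult: "scalar (a * b) = scalar a * scalar b" for a b
    by (simp add: scalar_def mult_single)
  show ?thesis
    using keys_scalar_mult[of c p]
    by (simp add: reorder_at_superset[of "Poly_Mapping.keys p"] lookup_scalar_mult mult sum_distrib_left mult.assoc)
qed

lemma reorder_at_monomial:
  "reorder_at n \<tau> (monomial gs) = monomial (take n gs) * \<tau> (gs ! n) (gs ! (n + 1)) * monomial (drop (n + 2) gs)"
  unfolding reorder_at_def
  by (simp add: monomial_def scalar_def)

section \<open>The reordering rule in solved form\<close>

fun symbol :: "kind \<Rightarrow> 'n \<Rightarrow> 'n \<Rightarrow> 'n gen" where
  "symbol A_kind = GenA"
| "symbol B_kind = GenB"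

lemma symbol_cases: obtains c i j where "x = symbol c i j"
  by (cases x) (metis symbol.simps)+

definition exchange_rule ::
    "'k::field \<Rightarrow> ('n gen \<Rightarrow> 'n gen \<Rightarrow> ('n::{finite,linorder} gen, 'k) free_alg) \<Rightarrow> bool" where
  "exchange_rule s \<tau> \<longleftrightarrow> (\<forall>c d i j k l. \<tau> (symbol c i j) (symbol d k l) =
     exchange (scalar (s\<^sup>2)) (scalar (inverse (s\<^sup>2))) c d
       (\<lambda>i j k l. monomial [symbol d k l, symbol c i j]) i j k l)"

lemma central_unit_pair_algebra_map:
  assumes "algebra_map \<iota>" "x * y = 1"
  shows "central_unit_pair (\<iota> x) (\<iota> y)"
proof
  show "\<iota> x * \<iota> y = 1" "\<iota> y * \<iota> x = 1"
    using assms by (metis algebra_map_def)+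
  show "\<iota> x * u = u * \<iota> x" "\<iota> y * u = u * \<iota> y" for u
    using assms(1) by (auto simp: algebra_map_def)
qed

lemma qR_field:
  fixes s :: "'k::field_char_0"
  assumes "s \<noteq> 0"
  shows "qR s = Rmat (s\<^sup>2) (inverse (s\<^sup>2))" "qR (inverse s) = Rmat (inverse (s\<^sup>2)) (s\<^sup>2)"
proof -
  show "qR s = Rmat (s\<^sup>2) (inverse (s\<^sup>2))"
    by (rule qR_eq_Rmat) (use assms in \<open>simp_all add: power_inverse\<close>)
  have "qR (inverse s) = Rmat ((inverse s)\<^sup>2) (inverse ((inverse s)\<^sup>2))"
    by (rule qR_eq_Rmat) (use assms in \<open>simp_all add: power_inverse\<close>)
  then show "qR (inverse s) = Rmat (inverse (s\<^sup>2)) (s\<^sup>2)"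
    by (simp add: power_inverse)
qed

text \<open>By linearity \<open>reorder_at 0 \<tau>\<close> passes through the crossings in the
  entries of the relations and acts on two-letter words, where it is \<open>\<tau>\<close>. Each
  relation is then solved for \<open>\<tau>\<close> by inverting crossings.\<close>

lemma reordering_rule_iff:
  fixes s :: "'k::field_char_0"
    and \<tau> :: "'n gen \<Rightarrow> 'n gen \<Rightarrow> ('n::{finite,linorder} gen, 'k) free_alg"
  assumes "s \<noteq> 0"
  shows "reordering_rule s \<tau> \<longleftrightarrow> exchange_rule s \<tau>"
proof -
  let ?p = "scalar (s\<^sup>2) :: ('n gen, 'k) free_alg"
  let ?p' = "scalar (inverse (s\<^sup>2)) :: ('n gen, 'k) free_alg"
  interpret central_unit_pair ?p ?p'
    by (rule central_unit_pair_algebra_map[OF algebra_map_scalar]) (use assms in simp)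
  note qR = qR_field[OF assms] map_matrix_Rmat[OF algebra_map_scalar]
  note hom = cross_hom[where f = "reorder_at n \<tau>" for n,
      OF reorder_at_add reorder_at_scale reorder_at_scale]
  have reorder: "reorder_at 0 \<tau> (monomial [x, y]) = \<tau> x y" for x y
    by (simp add: reorder_at_monomial)
  have gen: "genA $ i $ j * genA $ k $ l = monomial [symbol A_kind i j, symbol A_kind k l]"
    "genB $ i $ j * genB $ k $ l = monomial [symbol B_kind i j, symbol B_kind k l]"
    "genA $ i $ j * genB $ k $ l = monomial [symbol A_kind i j, symbol B_kind k l]"
    "genB $ i $ j * genA $ k $ l = monomial [symbol B_kind i j, symbol A_kind k l]" for i j k l :: 'n
    by (simp_all add: genA_def genB_def monomial_mult)
  have entries: "map_matrix f M = N \<longleftrightarrow> (\<forall>i j k l. f (M $ (i, k) $ (j, l)) = N $ (i, k) $ (j, l))"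
    for f :: "('n gen, 'k) free_alg \<Rightarrow> ('n gen, 'k) free_alg" and M N :: "(('n gen, 'k) free_alg, 'n) mat2"
    by (auto simp: vec_eq_iff)
  let ?rule = "\<lambda>c d. \<forall>i j k l. \<tau> (symbol c i j) (symbol d k l) =
     exchange ?p ?p' c d (\<lambda>i j k l. monomial [symbol d k l, symbol c i j]) i j k l"
  have "map_matrix (reorder_at 0 \<tau>) (AA_lhs scalar s genA) = AA_rhs scalar s genA \<longleftrightarrow> ?rule A_kind A_kind"
    unfolding entries AA_lhs_def AA_rhs_def qR AA_lhs_nth AA_rhs_nth hom gen reorder
    by (rule exchange_AA_iff)
  moreover have "map_matrix (reorder_at 0 \<tau>) (BB_lhs scalar s genB) = BB_rhs scalar s genB \<longleftrightarrow> ?rule B_kind B_kind"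
    unfolding entries BB_lhs_def BB_rhs_def qR BB_lhs_nth leg2_leg1_R_nth hom gen reorder
    by (rule exchange_BB_iff)
  moreover have "map_matrix (reorder_at 0 \<tau>) (AB_lhs scalar s genA genB) = AB_rhs scalar s genA genB \<longleftrightarrow>
    ?rule A_kind B_kind"
  proof -
    \<comment> \<open>Here A acts in space 2, so its indices are \<open>k, l\<close>. The
      quantifiers are renamed so that the first letter comes first.\<close>
    have "map_matrix (reorder_at 0 \<tau>) (AB_lhs scalar s genA genB) = AB_rhs scalar s genA genB \<longleftrightarrow>
      (\<forall>k l i j. cross ?p ?p' Over (\<lambda>j l. \<tau> (symbol A_kind k l) (symbol B_kind i j)) j l =
         cross ?p ?p' Under (\<lambda>k j. monomial [symbol B_kind i j, symbol A_kind k l]) k j)"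
      unfolding entries AB_lhs_def AB_rhs_def qR AB_rhs_nth leg2_leg1_R_nth hom gen reorder
      by blast
    also have "\<dots> \<longleftrightarrow> ?rule A_kind B_kind"
      by (rule exchange_AB_iff)
    finally show ?thesis .
  qed
  moreover have "map_matrix (reorder_at 0 \<tau>) (AB_rhs scalar s genA genB) = AB_lhs scalar s genA genB \<longleftrightarrow>
    ?rule B_kind A_kind"
    unfolding entries AB_lhs_def AB_rhs_def qR AB_rhs_nth leg2_leg1_R_nth hom gen reorder
    by (rule exchange_BA_iff)
  moreover have "exchange_rule s \<tau> \<longleftrightarrow> ?rule A_kind A_kind \<and> ?rule B_kind B_kind \<and>
    ?rule A_kind B_kind \<and> ?rule B_kind A_kind"
  proof -
    have all_kind: "(\<forall>c. P c) \<longleftrightarrow> P A_kind \<and> P B_kind" for P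
      by (metis kind.exhaust)
    show ?thesis
      unfolding exchange_rule_def all_kind by (simp only: conj_ac)
  qed
  ultimately show ?thesis
    by (simp only: reordering_rule_def)
qed

lemma ex1_exchange_rule:
  fixes s :: "'k::field"
  shows "\<exists>!\<tau> :: 'n gen \<Rightarrow> 'n gen \<Rightarrow> ('n::{finite,linorder} gen, 'k) free_alg. exchange_rule s \<tau>"
proof (rule ex_ex1I)
  define parts :: "'n gen \<Rightarrow> kind \<times> 'n \<times> 'n" where
    "parts x = (case x of GenA i j \<Rightarrow> (A_kind, i, j) | GenB i j \<Rightarrow> (B_kind, i, j))" for x
  have parts: "parts (symbol c i j) = (c, i, j)" for c i j
    by (cases c) (simp_all add: parts_def)
  show "\<exists>\<tau> :: 'n gen \<Rightarrow> 'n gen \<Rightarrow> ('n gen, 'k) free_alg. exchange_rule s \<tau>"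
    by (rule exI[of _ "\<lambda>x y. case parts x of (c, i, j) \<Rightarrow> case parts y of (d, k, l) \<Rightarrow>
         exchange (scalar (s\<^sup>2)) (scalar (inverse (s\<^sup>2))) c d
           (\<lambda>i j k l. monomial [symbol d k l, symbol c i j]) i j k l"])
       (simp add: exchange_rule_def parts)
next
  fix \<tau> \<tau>' :: "'n gen \<Rightarrow> 'n gen \<Rightarrow> ('n gen, 'k) free_alg"
  assume *: "exchange_rule s \<tau>" "exchange_rule s \<tau>'"
  have "\<tau> x y = \<tau>' x y" for x y
    by (rule symbol_cases[of x]; rule symbol_cases[of y]) (use * in \<open>simp add: exchange_rule_def\<close>)
  then show "\<tau> = \<tau>'"
    by blast
qed

text \<open>Letter number m becomes the cable in slots 2m and 2m + 1. Each reordering is a cable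
  crossing, and the two reversals are the two sides of the Yang-Baxter equation for the cables 0, 1,
  2.\<close>

lemma exchange_rule_triple_consistent:
  fixes s :: "'k::field_char_0"
    and \<tau> :: "'n gen \<Rightarrow> 'n gen \<Rightarrow> ('n::{finite,linorder} gen, 'k) free_alg"
  assumes "s \<noteq> 0" "exchange_rule s \<tau>"
  shows "triple_consistent \<tau>"
  unfolding triple_consistent_def
proof (intro allI)
  fix x y z :: "'n gen"
  let ?p = "scalar (s\<^sup>2) :: ('n gen, 'k) free_alg"
  let ?p' = "scalar (inverse (s\<^sup>2)) :: ('n gen, 'k) free_alg"
  interpret central_unit_pair ?p ?p'
    by (rule central_unit_pair_algebra_map[OF algebra_map_scalar]) (use assms in simp)
  obtain c\<^sub>0 i\<^sub>0 j\<^sub>0 c\<^sub>1 i\<^sub>1 j\<^sub>1 c\<^sub>2 i\<^sub>2 j\<^sub>2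
    where xyz: "x = symbol c\<^sub>0 i\<^sub>0 j\<^sub>0" "y = symbol c\<^sub>1 i\<^sub>1 j\<^sub>1" "z = symbol c\<^sub>2 i\<^sub>2 j\<^sub>2"
    by (metis symbol_cases)
  define K where "K m = [c\<^sub>0, c\<^sub>1, c\<^sub>2] ! m" for m
  define v where "v m = [i\<^sub>0, j\<^sub>0, i\<^sub>1, j\<^sub>1, i\<^sub>2, j\<^sub>2] ! m" for m
  define t where "t m = (K (m div 2), if even m then Left_side else Right_side)" for m :: nat
  define L where "L m u = symbol (K m) (u (2 * m)) (u (2 * m + 1))" for m and u :: "nat \<Rightarrow> 'n"
  define C :: "nat \<Rightarrow> nat \<Rightarrow> ((nat \<Rightarrow> 'n) \<Rightarrow> ('n gen, 'k) free_alg) \<Rightarrow> (nat \<Rightarrow> 'n) \<Rightarrow> ('n gen, 'k) free_alg"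
    where "C a b = cable_cross ?p ?p' t (2 * a) (2 * a + 1) (2 * b) (2 * b + 1)" for a b
  have C_hom: "f (C a b F u) = C a b (\<lambda>u. f (F u)) u"
    if "\<And>x y. f (x + y) = f x + f y" "\<And>c x. f (scalar c * x) = scalar c * f x" for f a b F u
    unfolding C_def using that by (intro cable_cross_hom)
  have C_exchange: "C a b F u = exchange ?p ?p' (K a) (K b) (\<lambda>i j k l.
      F (u(2 * a := i, 2 * a + 1 := j, 2 * b := k, 2 * b + 1 := l)))
      (u (2 * a)) (u (2 * a + 1)) (u (2 * b)) (u (2 * b + 1))" if "a \<noteq> b" for a b F u
  proof -
    have "distinct [2 * a, 2 * a + 1, 2 * b, 2 * b + 1]"
      using that by simp
    then show ?thesis
      unfolding C_def by (rule cable_cross_eq_exchange) (simp_all add: t_def)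
  qed
  have slots: "2 * a \<noteq> 2 * b" "2 * a + 1 \<noteq> 2 * b + 1" if "a \<noteq> b" for a b :: nat
    using that by auto
  have parity: "2 * a + 1 \<noteq> 2 * b" "2 * b \<noteq> 2 * a + 1" for a b :: nat
    by presburger+
  have \<tau>: "f (\<tau> (L a u) (L b u)) = exchange ?p ?p' (K a) (K b)
      (\<lambda>i j k l. f (monomial [symbol (K b) k l, symbol (K a) i j]))
      (u (2 * a)) (u (2 * a + 1)) (u (2 * b)) (u (2 * b + 1))"
    if "\<And>x y. f (x + y) = f x + f y" "\<And>c x. f (scalar c * x) = scalar c * f x" for f a b u
  proof -
    have "\<tau> (L a u) (L b u) = exchange ?p ?p' (K a) (K b)
      (\<lambda>i j k l. monomial [symbol (K b) k l, symbol (K a) i j])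
      (u (2 * a)) (u (2 * a + 1)) (u (2 * b)) (u (2 * b + 1))"
      unfolding L_def using assms(2) by (simp only: exchange_rule_def)
    then show ?thesis
      by (simp only: exchange_hom[of f, OF that(1) that(2) that(2)])
  qed
  have L_upd: "L d (u(2 * a := i, 2 * a + 1 := j, 2 * b := k, 2 * b + 1 := l)) = L d u"
      "L a (u(2 * a := i, 2 * a + 1 := j, 2 * b := k, 2 * b + 1 := l)) = symbol (K a) i j"
      "L b (u(2 * a := i, 2 * a + 1 := j, 2 * b := k, 2 * b + 1 := l)) = symbol (K b) k l"
    if "a \<noteq> b" "a \<noteq> d" "b \<noteq> d" for a b d i j k l u
    unfolding L_def fun_upd_apply using that slots parity by auto
  \<comment> \<open>Letters keep their original numbers when they change position, so the crossing
    is determined by \<open>a\<close> and \<open>b\<close> and not by their current places.\<close>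
  have reorder_first: "reorder_at 0 \<tau> (monomial [L a u, L b u, L d u]) = C a b (\<lambda>u. monomial [L b u, L a u, L d u]) u"
    if "a \<noteq> b" "a \<noteq> d" "b \<noteq> d" for a b d u
  proof -
    have "reorder_at 0 \<tau> (monomial [L a u, L b u, L d u]) = \<tau> (L a u) (L b u) * monomial [L d u]"
      by (simp add: reorder_at_monomial)
    also have "\<dots> = C a b (\<lambda>u. monomial [L b u, L a u, L d u]) u"
      unfolding C_exchange[OF that(1)] L_upd[OF that]
      by (subst \<tau>) (simp_all add: distrib_right mult.assoc monomial_mult)
    finally show ?thesis .
  qed
  have reorder_last: "reorder_at 1 \<tau> (monomial [L d u, L a u, L b u]) = C a b (\<lambda>u. monomial [L d u, L b u, L a u]) u"
    if "a \<noteq> b" "a \<noteq> d" "b \<noteq> d" for a b d u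
  proof -
    have "reorder_at 1 \<tau> (monomial [L d u, L a u, L b u]) = monomial [L d u] * \<tau> (L a u) (L b u)"
      by (simp add: reorder_at_monomial)
    also have "\<dots> = C a b (\<lambda>u. monomial [L d u, L b u, L a u]) u"
      unfolding C_exchange[OF that(1)] L_upd[OF that]
      by (subst \<tau>[of "(*) (monomial [L d u])"])
         (simp_all add: distrib_left monomial_mult scalar_left_commute)
    finally show ?thesis .
  qed
  \<comment> \<open>A later reordering acts inside an earlier crossing; hence the first reordering
    gives the outermost \<open>C\<close>.\<close>
  have lift: "reorder_at n \<tau> (C a b F u) = C a b (\<lambda>u. reorder_at n \<tau> (F u)) u" for n a b F u
    by (intro C_hom reorder_at_add reorder_at_scale)
  have "x = L 0 v" "y = L 1 v" "z = L 2 v"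
    by (simp_all add: xyz L_def K_def v_def eval_nat_numeral)
  moreover have "C 0 1 (C 0 2 (C 1 2 F)) = C 1 2 (C 0 2 (C 0 1 F))" for F
    unfolding C_def by (intro cable_cross_yang_baxter) simp
  ultimately show "reorder_at 0 \<tau> (reorder_at 1 \<tau> (reorder_at 0 \<tau> (monomial [x, y, z]))) =
     reorder_at 1 \<tau> (reorder_at 0 \<tau> (reorder_at 1 \<tau> (monomial [x, y, z])))"
    by (simp only: reorder_first reorder_last lift zero_neq_one one_neq_zero zero_neq_numeral
        numeral_neq_zero one_eq_numeral_iff numeral_eq_one_iff num.distinct not_False_eq_True)
qed

theorem jacobi_relations_qR:
  fixes s :: "'k::field_char_0"
  assumes "s \<noteq> 0"
  shows "jacobi_relations TYPE('n::{finite,linorder}) s"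
  unfolding jacobi_relations_def reordering_rule_iff[OF assms]
  using ex1_exchange_rule exchange_rule_triple_consistent[OF assms] by blast

subsection \<open>The quantum automorphism\<close>

lemma mat2_eqI:
  assumes "\<And>i k j l. M $ (i, k) $ (j, l) = N $ (i, k) $ (j, l)"
  shows "M = (N :: ('a, 'n::finite) mat2)"
  using assms by (simp add: vec_eq_iff)

lemma leg1_mult: "leg1 (X ** Y) = leg1 X ** leg1 Y"
  by (rule mat2_eqI, unfold leg1_mult_nth leg1_nth)
     (simp add: matrix_matrix_mult_def sum_distrib_right mult.assoc)

lemma leg2_mult: "leg2 (X ** Y) = leg2 X ** leg2 Y"
  by (rule mat2_eqI, unfold leg2_mult_nth leg2_nth) (auto simp: matrix_matrix_mult_def)

text \<open>Conjugation by the flip of the tensor factors, which turns M_12 into M_21.\<close>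

definition swap_legs :: "('a, 'n::finite) mat2 \<Rightarrow> ('a, 'n) mat2" where
  "swap_legs M = (\<chi> x y. M $ (snd x, fst x) $ (snd y, fst y))"

lemma swap_legs_nth [simp]: "swap_legs M $ (i, k) $ (j, l) = M $ (k, i) $ (l, j)"
  by (simp add: swap_legs_def)

lemma swap_legs_mult: "swap_legs (M ** N) = swap_legs M ** swap_legs N"
proof (rule mat2_eqI)
  fix i k j l
  show "swap_legs (M ** N) $ (i, k) $ (j, l) = (swap_legs M ** swap_legs N) $ (i, k) $ (j, l)"
    unfolding matrix_matrix_mult_def sum_UNIV_prod
    by (simp add: matrix_matrix_mult_def sum_UNIV_prod) (rule sum.swap)
qed

lemma swap_legs_leg: "swap_legs (leg1 X) = leg2 X" "swap_legs (leg2 X) = leg1 X"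
  by (auto intro!: mat2_eqI simp: leg1_nth leg2_nth)

lemma swap_legs_swap_legs [simp]: "swap_legs (swap_legs M) = M"
  by (rule mat2_eqI) simp

lemma transp1_mult_leg2: "transp1 (M ** leg2 X) = transp1 M ** leg2 X"
  by (rule mat2_eqI) (simp add: mult_leg2_nth)

lemma transp1_leg2_mult: "transp1 (leg2 X ** M) = leg2 X ** transp1 M"
  by (rule mat2_eqI) (simp add: leg2_mult_nth)

lemma transp2_mult_leg1: "transp2 (M ** leg1 X) = transp2 M ** leg1 X"
  by (rule mat2_eqI) (simp add: mult_leg1_nth)

lemma transp2_leg1_mult: "transp2 (leg1 X ** M) = leg1 X ** transp2 M"
  by (rule mat2_eqI) (simp add: leg1_mult_nth)

definition central_matrix :: "('a::semiring_1, 'n::finite) mat2 \<Rightarrow> bool" where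
  "central_matrix M \<longleftrightarrow> (\<forall>x y u. M $ x $ y * u = u * M $ x $ y)"

lemma central_matrix_nth: "central_matrix M \<Longrightarrow> M $ x $ y * u = u * M $ x $ y"
  unfolding central_matrix_def by blast

lemma central_matrix_transp1: "central_matrix M \<Longrightarrow> central_matrix (transp1 M)"
  by (simp add: central_matrix_def transp1_def)

lemma central_matrix_transp2: "central_matrix M \<Longrightarrow> central_matrix (transp2 M)"
  by (simp add: central_matrix_def transp2_def)

text \<open>Transposition in space 1 reverses products in that space only if the entries of the two
  factors commute, which centrality of \<open>M\<close> guarantees.\<close>

lemma transp1_central_leg1:
  assumes "central_matrix M"
  shows "transp1 (M ** leg1 X) = leg1 (transpose X) ** transp1 M"
    and "transp1 (leg1 X ** M) = transp1 M ** leg1 (transpose X)"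
  by (auto intro!: mat2_eqI simp: mult_leg1_nth leg1_mult_nth transpose_def central_matrix_nth[OF assms])

lemma transp2_central_leg2:
  assumes "central_matrix M"
  shows "transp2 (M ** leg2 X) = leg2 (transpose X) ** transp2 M"
    and "transp2 (leg2 X ** M) = transp2 M ** leg2 (transpose X)"
  by (auto intro!: mat2_eqI simp: mult_leg2_nth leg2_mult_nth transpose_def central_matrix_nth[OF assms])

text \<open>This is the identity R_12^{t_1 t_2} = R_21, from which the symmetries of the partial
  transposes follow.\<close>

lemma Rmat_symmetric: "Rmat p p' $ (a, b) $ (c, d) = Rmat p p' $ (d, c) $ (b, a)"
  unfolding Rmat_nth prod.inject
  by (cases "c = a"; cases "d = b"; cases "c = b"; cases "d = a") simp_all

lemma swap_legs_transp1_Rmat: "swap_legs (transp1 (Rmat p p')) = transp1 (Rmat p p')"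
  by (rule mat2_eqI) (metis swap_legs_nth transp1_nth Rmat_symmetric)

lemma swap_legs_transp2_Rmat: "swap_legs (transp2 (Rmat p p')) = transp2 (Rmat p p')"
  by (rule mat2_eqI) (metis swap_legs_nth transp2_nth Rmat_symmetric)

lemma transp1_transp2_Rmat: "transp1 (transp2 (Rmat p p')) = swap_legs (Rmat p p')"
  "transp2 (transp1 (Rmat p p')) = swap_legs (Rmat p p')"
  by (rule mat2_eqI, metis swap_legs_nth transp1_nth transp2_nth Rmat_symmetric)+

section \<open>Inverse of R and commutation with its partial transposes\<close>

lemma (in central_unit_pair) Rmat_mult_inverse:
  fixes M :: "('a, 'n::{finite,linorder}) mat2"
  shows "Rmat p p' ** (Rmat p' p ** M) = M"
proof (rule mat2_eqI)
  fix i k j l :: 'n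
  have "(Rmat p' p ** M) $ (i, k) $ y = cross p p' Under (\<lambda>i k. M $ (i, k) $ y) i k" for i k y
    unfolding matrix_matrix_mult_def by (simp only: vec_lambda_beta Rmat_sum_right Rmat_swap_eq_Under)
  then show "(Rmat p p' ** (Rmat p' p ** M)) $ (i, k) $ (j, l) = M $ (i, k) $ (j, l)"
    using cross_inverse[of Over "\<lambda>k i. M $ (i, k) $ (j, l)"] by (simp only: R_nth_mult inverse_crossing.simps)
qed

text \<open>On the span of the \<open>e_i \<otimes> e_i\<close> the matrix R is the central scalar
  \<open>p\<close>; on the complementary span, which R preserves, \<open>M\<close> is the
  identity.\<close>

lemma (in central_unit_pair) Rmat_commute:
  fixes M :: "('a, 'n::{finite,linorder}) mat2"
  assumes "\<And>i k j l. i \<noteq> k \<or> j \<noteq> l \<Longrightarrow> M $ (i, k) $ (j, l) = (if i = j \<and> k = l then 1 else 0)"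
  shows "Rmat p p' ** M = M ** Rmat p p'"
proof (rule mat2_eqI)
  fix i k j l :: 'n
  show "(Rmat p p' ** M) $ (i, k) $ (j, l) = (M ** Rmat p p') $ (i, k) $ (j, l)"
    unfolding R_nth_mult mult_R_nth
    using assms by (cases "i = k"; cases "j = l") (auto simp: assms)
qed

context central_unit_pair
begin

lemma central_unit_pair_swap: "central_unit_pair p' p"
  by unfold_locales (rule p'p pp' p_central p'_central)+

lemma central_matrix_R: "central_matrix (Rmat p p')" "central_matrix (Rmat p' p)"
  unfolding central_matrix_def using R_central Rmat_central[OF p'_central p_central] by blast+

lemma R_commute_transp1:
  "Rmat p p' ** transp1 (Rmat p p') = transp1 (Rmat p p') ** (Rmat p p' :: ('a, 'n::{finite,linorder}) mat2)"
proof (rule Rmat_commute)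
  fix i k j l :: 'n
  assume "i \<noteq> k \<or> j \<noteq> l"
  then show "transp1 (Rmat p p') $ (i, k) $ (j, l) = (if i = j \<and> k = l then 1 else 0)"
    unfolding transp1_nth Rmat_nth prod.inject
    by (cases "i = k"; cases "j = l"; cases "i = j"; cases "k = l") simp_all
qed

lemma R_commute_transp2:
  "Rmat p p' ** transp2 (Rmat p' p) = transp2 (Rmat p' p) ** (Rmat p p' :: ('a, 'n::{finite,linorder}) mat2)"
proof (rule Rmat_commute)
  fix i k j l :: 'n
  assume "i \<noteq> k \<or> j \<noteq> l"
  then show "transp2 (Rmat p' p) $ (i, k) $ (j, l) = (if i = j \<and> k = l then 1 else 0)"
    unfolding transp2_nth Rmat_nth prod.inject
    by (cases "i = k"; cases "j = l"; cases "i = j"; cases "k = l") simp_all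
qed

lemma quantum_automorphism:
  fixes A B :: "('a, 'n::{finite,linorder}) mat1"
  defines "R \<equiv> Rmat p p'" and "T \<equiv> transp1 (Rmat p p')" and "Q \<equiv> transp2 (Rmat p' p)"
  assumes AA: "R ** leg1 A ** T ** leg2 A = leg2 A ** T ** leg1 A ** R"
    and BB: "R ** leg1 B ** leg2 B = leg2 B ** leg1 B ** R"
    and AB: "leg2 A ** leg1 B ** R = leg1 B ** Q ** leg2 A"
  defines "Y \<equiv> B ** A ** transpose B"
  shows "R ** leg1 Y ** T ** leg2 Y = leg2 Y ** T ** leg1 Y ** R"
proof -
  \<comment> \<open>\<open>R'\<close>, \<open>S\<close> and \<open>S'\<close> are the inverse of
    R_12, R_21 and the inverse of R_21.\<close>
  define R' :: "('a, 'n) mat2" where "R' = Rmat p' p"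
  define S where "S = swap_legs R"
  define S' where "S' = swap_legs R'"
  let ?A1 = "leg1 A" and ?A2 = "leg2 A" and ?B1 = "leg1 B" and ?B2 = "leg2 B"
  let ?C1 = "leg1 (transpose B)" and ?C2 = "leg2 (transpose B)"
  have central: "central_matrix R" "central_matrix T" "central_matrix Q"
    by (simp_all add: R_def T_def Q_def central_matrix_R central_matrix_transp1 central_matrix_transp2)
  have swap: "swap_legs T = T" "swap_legs Q = Q" "swap_legs R = S" "swap_legs S = R" "swap_legs S' = R'"
    by (simp_all add: T_def Q_def S_def S'_def swap_legs_transp1_Rmat swap_legs_transp2_Rmat)
  have transp: "transp1 R = T" "transp2 T = S" "transp1 Q = S'"
    by (simp_all add: R_def T_def Q_def S_def S'_def R'_def transp1_transp2_Rmat)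
  have RR': "R ** (R' ** M) = M" for M :: "('a, 'n) mat2"
    by (simp add: R_def R'_def Rmat_mult_inverse)
  have "R' ** (R ** M) = M" for M :: "('a, 'n) mat2"
    unfolding R_def R'_def by (rule central_unit_pair.Rmat_mult_inverse[OF central_unit_pair_swap])
  note inv = RR' this
  have SS': "S ** (S' ** M) = M" "S' ** (S ** M) = M" for M :: "('a, 'n) mat2"
    using inv[of "swap_legs M"] by (metis swap swap_legs_mult swap_legs_swap_legs S'_def)+
  have RT: "R ** T = T ** R" and RQ: "R ** Q = Q ** R"
    by (simp_all add: R_def T_def Q_def R_commute_transp1 R_commute_transp2)
  have ST: "S ** T = T ** S"
    using RT by (metis swap swap_legs_mult)
  \<comment> \<open>Transposition t_1 of the relation for B.\<close>
  have CTB: "?C1 ** T ** ?B2 = ?B2 ** T ** ?C1"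
  proof -
    have "transp1 (R ** ?B1 ** ?B2) = ?C1 ** T ** ?B2"
      by (simp add: transp1_mult_leg2 transp1_central_leg1 central transp)
    moreover have "transp1 (?B2 ** ?B1 ** R) = ?B2 ** T ** ?C1"
      by (simp add: transp1_leg2_mult transp1_central_leg1 central transp flip: matrix_mul_assoc)
    ultimately show ?thesis
      using BB by simp
  qed
  have BTC: "?C2 ** T ** ?B1 = ?B1 ** T ** ?C2"
    using arg_cong[OF CTB, of swap_legs] by (simp add: swap_legs_mult swap_legs_leg swap)
  \<comment> \<open>Transposition t_2 of \<open>CTB\<close>, followed by the flip.\<close>
  have CCR: "?C2 ** ?C1 ** R = R ** ?C1 ** ?C2"
  proof -
    have "transp2 (?C1 ** (T ** ?B2)) = ?C1 ** ?C2 ** S"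
      by (simp only: transp2_leg1_mult transp2_central_leg2[OF central(2)] transp) (simp only: matrix_mul_assoc)
    moreover have "transp2 (?B2 ** T ** ?C1) = S ** ?C2 ** ?C1"
      by (simp add: transp2_mult_leg1 transp2_central_leg2 central transp)
    ultimately have "?C1 ** ?C2 ** S = S ** ?C2 ** ?C1"
      using CTB by (simp add: matrix_mul_assoc)
    then have "swap_legs (?C1 ** ?C2 ** S) = swap_legs (S ** ?C2 ** ?C1)"
      by simp
    then show ?thesis
      by (simp add: swap_legs_mult swap_legs_leg swap)
  qed
  \<comment> \<open>Transposition t_1 of the mixed relation; R_12^{t_2}(1/q) becomes R_21(1/q), the
    inverse of \<open>S\<close>.\<close>
  have ATC: "?A2 ** T ** ?C1 = S' ** ?C1 ** ?A2"
  proof -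
    have "transp1 (?A2 ** ?B1 ** R) = ?A2 ** T ** ?C1"
      by (simp add: transp1_leg2_mult transp1_central_leg1 central transp flip: matrix_mul_assoc)
    moreover have "transp1 (?B1 ** Q ** ?A2) = S' ** ?C1 ** ?A2"
      by (simp add: transp1_mult_leg2 transp1_central_leg1 central transp)
    ultimately show ?thesis
      using AB by simp
  qed
  have ATC': "?A1 ** T ** ?C2 = R' ** ?C2 ** ?A1"
    using arg_cong[OF ATC, of swap_legs] by (simp add: swap_legs_mult swap_legs_leg swap)
  have AB': "?A1 ** ?B2 ** S = ?B2 ** Q ** ?A1"
    using arg_cong[OF AB, of swap_legs] by (simp add: swap_legs_mult swap_legs_leg swap)
  note a = matrix_mul_assoc
  \<comment> \<open>The rules 1 to 9, 11 and 12 carry a trailing factor \<open>M\<close> in order to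
    rewrite inside right-nested products.\<close>
  have 1: "?C1 ** (T ** (?B2 ** M)) = ?B2 ** (T ** (?C1 ** M))" for M :: "('a, 'n) mat2"
    using arg_cong[OF CTB, of "\<lambda>Z. Z ** M"] by (simp only: a[symmetric])
  have 2: "?A1 ** (?B2 ** M) = ?B2 ** (Q ** (?A1 ** (S' ** M)))" for M :: "('a, 'n) mat2"
    using arg_cong[OF AB', of "\<lambda>Z. Z ** (S' ** M)"] by (simp only: a[symmetric] SS')
  have 3: "?C1 ** (?A2 ** M) = S ** (?A2 ** (T ** (?C1 ** M)))" for M :: "('a, 'n) mat2"
    using arg_cong[OF ATC, of "\<lambda>Z. S ** (Z ** M)"] by (simp only: a[symmetric] SS')
  have 4: "S' ** (T ** (S ** M)) = T ** M" for M :: "('a, 'n) mat2"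
    using arg_cong[OF ST, of "\<lambda>Z. S' ** (Z ** M)"] by (simp only: a[symmetric] SS')
  have 5: "R ** (?B1 ** (?B2 ** M)) = ?B2 ** (?B1 ** (R ** M))" for M :: "('a, 'n) mat2"
    using arg_cong[OF BB, of "\<lambda>Z. Z ** M"] by (simp only: a[symmetric])
  have 6: "R ** (Q ** M) = Q ** (R ** M)" for M :: "('a, 'n) mat2"
    using arg_cong[OF RQ, of "\<lambda>Z. Z ** M"] by (simp only: a[symmetric])
  have 7: "R ** (?A1 ** (T ** (?A2 ** M))) = ?A2 ** (T ** (?A1 ** (R ** M)))" for M :: "('a, 'n) mat2"
    using arg_cong[OF AA, of "\<lambda>Z. Z ** M"] by (simp only: a[symmetric])
  have 8: "?B1 ** (Q ** (?A2 ** M)) = ?A2 ** (?B1 ** (R ** M))" for M :: "('a, 'n) mat2"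
    using arg_cong[OF AB, of "\<lambda>Z. Z ** M"] by (simp only: a[symmetric])
  have 9: "R ** (T ** M) = T ** (R ** M)" for M :: "('a, 'n) mat2"
    using arg_cong[OF RT, of "\<lambda>Z. Z ** M"] by (simp only: a[symmetric])
  have 10: "R ** (?C1 ** ?C2) = ?C2 ** (?C1 ** R)"
    using CCR by (simp only: a)
  have 11: "?A1 ** (T ** (?C2 ** M)) = R' ** (?C2 ** (?A1 ** M))" for M :: "('a, 'n) mat2"
    using arg_cong[OF ATC', of "\<lambda>Z. Z ** M"] by (simp only: a[symmetric])
  have 12: "?B1 ** (T ** (?C2 ** M)) = ?C2 ** (T ** (?B1 ** M))" for M :: "('a, 'n) mat2"
    using arg_cong[OF BTC, of "\<lambda>Z. Z ** M"] by (simp only: a[symmetric])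
  have "R ** leg1 Y ** T ** leg2 Y =
    R ** (?B1 ** (?A1 ** (?C1 ** (T ** (?B2 ** (?A2 ** ?C2))))))"
    by (simp add: Y_def leg1_mult leg2_mult flip: a)
  also have "\<dots> = R ** (?B1 ** (?A1 ** (?B2 ** (T ** (?C1 ** (?A2 ** ?C2))))))"
    by (simp only: 1)
  \<comment> \<open>Moving \<open>?A1\<close> past \<open>?B2\<close> and \<open>?C1\<close> past
    \<open>?A2\<close> leaves \<open>S' ** T ** S\<close> in the middle, which is
    \<open>T\<close>.\<close>
  also have "\<dots> = R ** (?B1 ** (?B2 ** (Q ** (?A1 ** (S' ** (T ** (S ** (?A2 ** (T ** (?C1 ** ?C2))))))))))"
    by (simp only: 2 3)
  also have "\<dots> = ?B2 ** (?B1 ** (Q ** (R ** (?A1 ** (T ** (?A2 ** (T ** (?C1 ** ?C2))))))))"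
    by (simp only: 4 5 6)
  \<comment> \<open>With all factors from B outside, the relation for A applies once; the mixed
    relation then takes \<open>?A2\<close> to the left of \<open>?B1\<close>.\<close>
  also have "\<dots> = ?B2 ** (?A2 ** (?B1 ** (R ** (T ** (?A1 ** (R ** (T ** (?C1 ** ?C2))))))))"
    by (simp only: 7 8)
  also have "\<dots> = ?B2 ** (?A2 ** (?B1 ** (T ** (R ** (?A1 ** (T ** (?C2 ** (?C1 ** R))))))))"
    by (simp only: 9 10)
  \<comment> \<open>Moving \<open>?C2\<close> past \<open>?A1\<close> produces \<open>R'\<close>,
    which cancels the remaining inner \<open>R\<close>.\<close>
  also have "\<dots> = ?B2 ** (?A2 ** (?C2 ** (T ** (?B1 ** (?A1 ** (?C1 ** R))))))"
    by (simp only: 11 inv(1) 12)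
  also have "\<dots> = leg2 Y ** T ** leg1 Y ** R"
    by (simp add: Y_def leg1_mult leg2_mult flip: a)
  finally show ?thesis .
qed

end

subsection \<open>First order expansion\<close>

text \<open>\<open>r\<^sub>1\<^sub>2\<close> for the opposite order of the indices: the first order term of \<open>R\<^sub>1\<^sub>2\<close>.\<close>

definition rmat_opp :: "('a::ring_1, 'n::{finite,linorder}) mat2" where
  "rmat_opp = (\<chi> x y. (if y = x then if fst x = snd x then 1 else 0 else 0) +
     (if y = (snd x, fst x) then if fst x < snd x then 2 else 0 else 0))"

lemma scaled_matrix_mult:
  fixes N :: "('a::ring_1, 'n::finite) mat2"
  assumes "\<And>x. h * x = x * h"
  shows "map_matrix ((*) h) M ** N = map_matrix ((*) h) (M ** N)"
    and "M ** map_matrix ((*) h) N = map_matrix ((*) h) (M ** N)"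
proof -
  show "map_matrix ((*) h) M ** N = map_matrix ((*) h) (M ** N)"
    by (simp add: vec_eq_iff matrix_matrix_mult_def sum_distrib_left mult.assoc)
  have "x * (h * y) = h * (x * y)" for x y
    by (metis assms mult.assoc)
  then show "M ** map_matrix ((*) h) N = map_matrix ((*) h) (M ** N)"
    by (simp add: vec_eq_iff matrix_matrix_mult_def sum_distrib_left)
qed

lemma mat2_add_rdistrib: "(A + B) ** (C :: ('a::ring_1, 'n::finite) mat2) = A ** C + B ** C"
  by (simp add: vec_eq_iff matrix_matrix_mult_def distrib_right sum.distrib)

lemma mat2_diff_rdistrib: "(A - B) ** (C :: ('a::ring_1, 'n::finite) mat2) = A ** C - B ** C"
  by (simp add: vec_eq_iff matrix_matrix_mult_def left_diff_distrib sum_subtractf)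

lemma mat2_minus_mult:
  "(- A) ** (C :: ('a::ring_1, 'n::finite) mat2) = - (A ** C)"
  "A ** (- C) = - (A ** C)"
  by (simp_all add: vec_eq_iff matrix_matrix_mult_def sum_negf)

lemma mat2_zero_mult: "0 ** (C :: ('a::ring_1, 'n::finite) mat2) = 0" "C ** 0 = 0"
  by (simp_all add: vec_eq_iff matrix_matrix_mult_def)

lemma map_matrix_mult_add:
  "map_matrix ((*) (h::'a::ring_1)) (M + N) = map_matrix ((*) h) M + map_matrix ((*) h) N"
  by (simp add: vec_eq_iff distrib_left)

lemma map_matrix_mult_diff:
  "map_matrix ((*) (h::'a::ring_1)) (M - N) = map_matrix ((*) h) M - map_matrix ((*) h) N"
  by (simp add: vec_eq_iff right_diff_distrib)

lemma map_matrix_mult_mult: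
  "map_matrix ((*) (h::'a::ring_1)) (map_matrix ((*) k) M) = map_matrix ((*) (h * k)) M"
  by (simp add: vec_eq_iff mult.assoc)

text \<open>\<open>M\<^sub>0\<close> and \<open>M\<^sub>1\<close> may themselves involve
  \<open>h\<close> and are not determined by \<open>M\<close>; products of operators in a fixed
  order thus count as terms of order zero.\<close>

definition first_order :: "'a::ring_1 \<Rightarrow> ('a, 'n::finite) mat2 \<Rightarrow> ('a, 'n) mat2 \<Rightarrow> ('a, 'n) mat2 \<Rightarrow> bool"
  where "first_order h M M\<^sub>0 M\<^sub>1 \<longleftrightarrow>
    (\<exists>C. M = M\<^sub>0 + map_matrix ((*) h) M\<^sub>1 + map_matrix ((*) (h\<^sup>2)) C)"

lemma first_order_const: "first_order h M M 0"
  unfolding first_order_def by (rule exI[of _ 0]) (simp add: vec_eq_iff)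

lemma first_order_mult:
  assumes h: "\<And>x. h * x = x * h" and "first_order h M M\<^sub>0 M\<^sub>1" "first_order h N N\<^sub>0 N\<^sub>1"
  shows "first_order h (M ** N) (M\<^sub>0 ** N\<^sub>0) (M\<^sub>0 ** N\<^sub>1 + M\<^sub>1 ** N\<^sub>0)"
proof -
  obtain C D where CD: "M = M\<^sub>0 + map_matrix ((*) h) M\<^sub>1 + map_matrix ((*) (h\<^sup>2)) C"
    "N = N\<^sub>0 + map_matrix ((*) h) N\<^sub>1 + map_matrix ((*) (h\<^sup>2)) D"
    using assms(2,3) unfolding first_order_def by blast
  have h2: "h\<^sup>2 * x = x * h\<^sup>2" for x
    by (metis h mult.assoc power2_eq_square)
  have "M ** N = M\<^sub>0 ** N\<^sub>0 + map_matrix ((*) h) (M\<^sub>0 ** N\<^sub>1 + M\<^sub>1 ** N\<^sub>0) + map_matrix ((*) (h\<^sup>2))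
     (M\<^sub>0 ** D + M\<^sub>1 ** N\<^sub>1 + map_matrix ((*) h) (M\<^sub>1 ** D) + C ** N)"
  proof -
    have "M ** N = M\<^sub>0 ** N + map_matrix ((*) h) (M\<^sub>1 ** N) + map_matrix ((*) (h\<^sup>2)) (C ** N)"
      unfolding CD(1) mat2_add_rdistrib scaled_matrix_mult[OF h] scaled_matrix_mult[OF h2] ..
    also have "M\<^sub>0 ** N = M\<^sub>0 ** N\<^sub>0 + map_matrix ((*) h) (M\<^sub>0 ** N\<^sub>1) + map_matrix ((*) (h\<^sup>2)) (M\<^sub>0 ** D)"
      unfolding CD(2) matrix_add_ldistrib scaled_matrix_mult[OF h] scaled_matrix_mult[OF h2] ..
    also have "map_matrix ((*) h) (M\<^sub>1 ** N) = map_matrix ((*) h) (M\<^sub>1 ** N\<^sub>0) +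
       map_matrix ((*) (h\<^sup>2)) (M\<^sub>1 ** N\<^sub>1) + map_matrix ((*) (h\<^sup>2)) (map_matrix ((*) h) (M\<^sub>1 ** D))"
      unfolding CD(2) matrix_add_ldistrib scaled_matrix_mult[OF h] scaled_matrix_mult[OF h2]
        map_matrix_mult_add map_matrix_mult_mult
      by (simp add: power2_eq_square mult.assoc)
    finally show ?thesis
      by (simp add: map_matrix_mult_add algebra_simps)
  qed
  then show ?thesis
    unfolding first_order_def by blast
qed

text \<open>Two expansions of the same matrix may differ already in order zero, but then by a
  multiple of \<open>h\<close>. For the two sides of a quantum relation this difference is the
  commutator.\<close>

lemma first_order_unique:
  assumes "first_order h M M\<^sub>0 M\<^sub>1" "first_order h M N\<^sub>0 N\<^sub>1"
  obtains C where "M\<^sub>0 - N\<^sub>0 = map_matrix ((*) h) (N\<^sub>1 - M\<^sub>1) + map_matrix ((*) (h\<^sup>2)) C"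
proof -
  obtain C D where CD: "M = M\<^sub>0 + map_matrix ((*) h) M\<^sub>1 + map_matrix ((*) (h\<^sup>2)) C"
    "M = N\<^sub>0 + map_matrix ((*) h) N\<^sub>1 + map_matrix ((*) (h\<^sup>2)) D"
    using assms unfolding first_order_def by blast
  have "M\<^sub>0 - N\<^sub>0 = map_matrix ((*) h) (N\<^sub>1 - M\<^sub>1) + map_matrix ((*) (h\<^sup>2)) (D - C)"
    using CD(1)[symmetric] CD(2) by (simp add: map_matrix_mult_diff algebra_simps)
  then show ?thesis
    by (rule that)
qed

text \<open>
  The quantum relations produce \<open>Q P \<rho>\<close>, the Poisson brackets contain \<open>P Q \<rho>\<close>; they differ in order
  \<open>h\<close> since \<open>P Q - Q P\<close> is itself of order \<open>h\<close>.
\<close>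

lemma first_order_commutator:
  assumes h: "\<And>x. h * x = x * h"
    and "first_order h M (P ** Q) M\<^sub>1" "first_order h M (Q ** P) (N\<^sub>1 + Q ** P ** \<rho>)"
  shows "\<exists>C. P ** Q - Q ** P = map_matrix ((*) h) (N\<^sub>1 + P ** Q ** \<rho> - M\<^sub>1) + map_matrix ((*) (h\<^sup>2)) C"
proof -
  obtain C where C: "P ** Q - Q ** P =
      map_matrix ((*) h) (N\<^sub>1 + Q ** P ** \<rho> - M\<^sub>1) + map_matrix ((*) (h\<^sup>2)) C"
    using first_order_unique[OF assms(2,3)] .
  let ?D = "N\<^sub>1 + Q ** P ** \<rho> - M\<^sub>1 + map_matrix ((*) h) C"
  have "P ** Q - Q ** P = map_matrix ((*) h) ?D"
    unfolding C by (simp add: map_matrix_mult_add map_matrix_mult_mult power2_eq_square)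
  then have "Q ** P = P ** Q - map_matrix ((*) h) ?D"
    by (simp add: algebra_simps)
  then have "Q ** P ** \<rho> = P ** Q ** \<rho> - map_matrix ((*) h) (?D ** \<rho>)"
    by (metis mat2_diff_rdistrib scaled_matrix_mult(1)[OF h])
  then obtain E where E: "Q ** P ** \<rho> = P ** Q ** \<rho> - map_matrix ((*) h) E"
    by blast
  have "P ** Q - Q ** P = map_matrix ((*) h) (N\<^sub>1 + P ** Q ** \<rho> - M\<^sub>1) +
      map_matrix ((*) (h\<^sup>2)) (C - E)"
    unfolding C E
    by (simp add: map_matrix_mult_add map_matrix_mult_diff map_matrix_mult_mult power2_eq_square)
  then show ?thesis
    by blast
qed

lemma first_order_transp:
  assumes "first_order h M M\<^sub>0 M\<^sub>1"
  shows "first_order h (transp1 M) (transp1 M\<^sub>0) (transp1 M\<^sub>1)"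
    and "first_order h (transp2 M) (transp2 M\<^sub>0) (transp2 M\<^sub>1)"
proof -
  obtain C where C: "M = M\<^sub>0 + map_matrix ((*) h) M\<^sub>1 + map_matrix ((*) (h\<^sup>2)) C"
    using assms unfolding first_order_def by blast
  show "first_order h (transp1 M) (transp1 M\<^sub>0) (transp1 M\<^sub>1)"
    unfolding first_order_def C by (rule exI[of _ "transp1 C"]) (simp add: transp1_def vec_eq_iff)
  show "first_order h (transp2 M) (transp2 M\<^sub>0) (transp2 M\<^sub>1)"
    unfolding first_order_def C by (rule exI[of _ "transp2 C"]) (simp add: transp2_def vec_eq_iff)
qed

lemma first_order_minus: "first_order (- h) M M\<^sub>0 M\<^sub>1 \<longleftrightarrow> first_order h M M\<^sub>0 (- M\<^sub>1)"
proof -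
  have "map_matrix ((*) (- h)) M\<^sub>1 = map_matrix ((*) h) (- M\<^sub>1)"
    by (simp add: vec_eq_iff)
  then show ?thesis
    by (simp add: first_order_def)
qed

text \<open>To first order \<open>p\<close> contributes -h on the diagonal and \<open>p - p'\<close>
  contributes -2h off it, whence the coefficients 1 and 2 in \<open>rmat_opp\<close>.\<close>

lemma first_order_Rmat:
  fixes p p' h c c' :: "'a::ring_1"
  assumes "p = 1 - h + h\<^sup>2 * c" "p' = 1 + h + h\<^sup>2 * c'"
  shows "first_order h (Rmat p p') (mat 1) (- rmat_opp :: ('a, 'n::{finite,linorder}) mat2)"
  unfolding first_order_def
proof (rule exI)
  let ?C = "(\<chi> x y. (if y = x then if fst x = snd x then c else 0 else 0) +
     (if y = (snd x, fst x) then if fst x < snd x then c - c' else 0 else 0)) :: ('a, 'n) mat2"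
  have diag: "(if P then if Q then p else 1 else 0) = (if P then 1 else 0) +
      h * - (if P then if Q then 1 else 0 else 0) + h\<^sup>2 * (if P then if Q then c else 0 else 0)" for P Q
    using assms(1) by simp
  have off: "(if P then if Q then p - p' else 0 else 0) =
      h * - (if P then if Q then 2 else 0 else 0) + h\<^sup>2 * (if P then if Q then c - c' else 0 else 0)" for P Q
  proof -
    have "p - p' = h * - 2 + h\<^sup>2 * (c - c')"
      unfolding assms by (simp add: algebra_simps mult_2_right)
    then show ?thesis by simp
  qed
  show "(Rmat p p' :: ('a, 'n) mat2) = mat 1 + map_matrix ((*) h) (- rmat_opp) + map_matrix ((*) (h\<^sup>2)) ?C"
    unfolding vec_eq_iff
  proof (intro allI)
    fix x y :: "'n \<times> 'n"
    have "Rmat p p' $ x $ y = ((if y = x then 1 else 0) +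
        h * - (if y = x then if fst x = snd x then 1 else 0 else 0) +
        h\<^sup>2 * (if y = x then if fst x = snd x then c else 0 else 0)) +
        (h * - (if y = (snd x, fst x) then if fst x < snd x then 2 else 0 else 0) +
         h\<^sup>2 * (if y = (snd x, fst x) then if fst x < snd x then c - c' else 0 else 0))"
      unfolding Rmat_def vec_lambda_beta diag off ..
    also have "\<dots> = (mat 1 + map_matrix ((*) h) (- rmat_opp) + map_matrix ((*) (h\<^sup>2)) ?C) $ x $ y"
      unfolding rmat_opp_def mat_def
      by (simp only: vector_add_component vector_uminus_component nth_map_matrix vec_lambda_beta
          eq_commute[of x y] distrib_left minus_add_distrib add_ac)
    finally show "Rmat p p' $ x $ y =
      (mat 1 + map_matrix ((*) h) (- rmat_opp) + map_matrix ((*) (h\<^sup>2)) ?C) $ x $ y" .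
  qed
qed

text \<open>Both sides of each relation are expanded to first order; their terms of order zero are
  the two orders of the product of the operators.\<close>

lemma semiclassical_commutators:
  fixes A B :: "('a::ring_1, 'n::{finite,linorder}) mat1" and p p' h c c' :: 'a
  assumes h: "\<And>x. h * x = x * h"
    and p: "p = 1 - h + h\<^sup>2 * c" and p': "p' = 1 + h + h\<^sup>2 * c'"
    and AA: "Rmat p p' ** leg1 A ** transp1 (Rmat p p') ** leg2 A =
      leg2 A ** transp1 (Rmat p p') ** leg1 A ** Rmat p p'"
    and BB: "Rmat p p' ** leg1 B ** leg2 B = leg2 B ** leg1 B ** Rmat p p'"
    and AB: "leg2 A ** leg1 B ** Rmat p p' = leg1 B ** transp2 (Rmat p' p) ** leg2 A"
  shows "\<exists>C. leg1 A ** leg2 A - leg2 A ** leg1 A = map_matrix ((*) h)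
      (rmat_opp ** leg1 A ** leg2 A - leg1 A ** leg2 A ** rmat_opp +
       leg1 A ** transp1 rmat_opp ** leg2 A - leg2 A ** transp1 rmat_opp ** leg1 A) + map_matrix ((*) (h\<^sup>2)) C"
    and "\<exists>C. leg1 B ** leg2 B - leg2 B ** leg1 B = map_matrix ((*) h)
      (rmat_opp ** leg1 B ** leg2 B - leg1 B ** leg2 B ** rmat_opp) + map_matrix ((*) (h\<^sup>2)) C"
    and "\<exists>C. leg1 B ** leg2 A - leg2 A ** leg1 B = map_matrix ((*) h)
      (- (leg1 B ** transp2 rmat_opp ** leg2 A) - leg1 B ** leg2 A ** rmat_opp) + map_matrix ((*) (h\<^sup>2)) C"
proof -
  let ?A1 = "leg1 A" and ?A2 = "leg2 A" and ?B1 = "leg1 B" and ?B2 = "leg2 B"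
  let ?\<rho> = "rmat_opp :: ('a, 'n) mat2"
  have one: "transp1 (mat 1) = (mat 1 :: ('a, 'n) mat2)" "transp2 (mat 1) = (mat 1 :: ('a, 'n) mat2)"
    by (auto intro!: mat2_eqI simp: mat_def)
  have minus: "transp1 (- M) = - transp1 M" "transp2 (- M) = - transp2 M" for M :: "('a, 'n) mat2"
    by (auto intro!: mat2_eqI)
  have R: "first_order h (Rmat p p') (mat 1 :: ('a, 'n) mat2) (- ?\<rho>)"
    using p p' by (rule first_order_Rmat)
  have T: "first_order h (transp1 (Rmat p p')) (mat 1 :: ('a, 'n) mat2) (- transp1 ?\<rho>)"
    using first_order_transp(1)[OF R] by (simp only: one minus)
  \<comment> \<open>\<open>R(q\<^sup>-\<^sup>1)\<close> is \<open>R(q)\<close> with \<open>h\<close> replaced by \<open>- h\<close>.\<close>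
  have "first_order (- h) (Rmat p' p) (mat 1 :: ('a, 'n) mat2) (- ?\<rho>)"
    using p p' by (intro first_order_Rmat) simp_all
  then have "first_order h (Rmat p' p) (mat 1 :: ('a, 'n) mat2) ?\<rho>"
    by (simp add: first_order_minus)
  then have Q: "first_order h (transp2 (Rmat p' p)) (mat 1 :: ('a, 'n) mat2) (transp2 ?\<rho>)"
    using first_order_transp(2) by (metis one(2))
  note mult = first_order_mult[OF h] and const = first_order_const
  note simps = mat2_zero_mult mat2_minus_mult matrix_mul_lid matrix_mul_rid add_0_left add_0_right

  have 1: "first_order h (Rmat p p' ** ?A1 ** transp1 (Rmat p p') ** ?A2) (?A1 ** ?A2)
      (- (?A1 ** transp1 ?\<rho> ** ?A2) - ?\<rho> ** ?A1 ** ?A2)"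
    using mult[OF mult[OF mult[OF R const[of h ?A1]] T] const[of h ?A2]]
    by (simp only: simps mat2_add_rdistrib diff_conv_add_uminus)
  \<comment> \<open>The last summand is kept in the form \<open>Q ** P ** \<rho>\<close> of
    \<open>first_order_commutator\<close>, with \<open>- rmat_opp\<close> for its
    \<open>\<rho>\<close>.\<close>
  have 2: "first_order h (?A2 ** transp1 (Rmat p p') ** ?A1 ** Rmat p p') (?A2 ** ?A1)
      (- (?A2 ** transp1 ?\<rho> ** ?A1) + ?A2 ** ?A1 ** (- ?\<rho>))"
    using mult[OF mult[OF mult[OF const[of h ?A2] T] const[of h ?A1]] R]
    by (simp only: simps add.commute)
  show "\<exists>C. ?A1 ** ?A2 - ?A2 ** ?A1 = map_matrix ((*) h)
      (?\<rho> ** ?A1 ** ?A2 - ?A1 ** ?A2 ** ?\<rho> + ?A1 ** transp1 ?\<rho> ** ?A2 - ?A2 ** transp1 ?\<rho> ** ?A1) +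
      map_matrix ((*) (h\<^sup>2)) C"
  proof -
    have "- (?A2 ** transp1 ?\<rho> ** ?A1) + ?A1 ** ?A2 ** (- ?\<rho>) - (- (?A1 ** transp1 ?\<rho> ** ?A2) - ?\<rho> ** ?A1 ** ?A2) =
      ?\<rho> ** ?A1 ** ?A2 - ?A1 ** ?A2 ** ?\<rho> + ?A1 ** transp1 ?\<rho> ** ?A2 - ?A2 ** transp1 ?\<rho> ** ?A1"
      by (simp add: simps)
    then show ?thesis
      using first_order_commutator[OF h 1 2[folded AA]] by (simp only:)
  qed

  have 3: "first_order h (Rmat p p' ** ?B1 ** ?B2) (?B1 ** ?B2) (- (?\<rho> ** ?B1 ** ?B2))"
    using mult[OF mult[OF R const[of h ?B1]] const[of h ?B2]] by (simp only: simps)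
  have 4: "first_order h (?B2 ** ?B1 ** Rmat p p') (?B2 ** ?B1) (0 + ?B2 ** ?B1 ** (- ?\<rho>))"
    using mult[OF mult[OF const[of h ?B2] const[of h ?B1]] R] by (simp only: simps)
  show "\<exists>C. ?B1 ** ?B2 - ?B2 ** ?B1 = map_matrix ((*) h)
      (?\<rho> ** ?B1 ** ?B2 - ?B1 ** ?B2 ** ?\<rho>) + map_matrix ((*) (h\<^sup>2)) C"
  proof -
    have "0 + ?B1 ** ?B2 ** (- ?\<rho>) - (- (?\<rho> ** ?B1 ** ?B2)) = ?\<rho> ** ?B1 ** ?B2 - ?B1 ** ?B2 ** ?\<rho>"
      by (simp add: simps)
    then show ?thesis
      using first_order_commutator[OF h 3 4[folded BB]] by (simp only:)
  qed

  have 5: "first_order h (?B1 ** transp2 (Rmat p' p) ** ?A2) (?B1 ** ?A2) (?B1 ** transp2 ?\<rho> ** ?A2)"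
    using mult[OF mult[OF const[of h ?B1] Q] const[of h ?A2]] by (simp only: simps)
  have 6: "first_order h (?A2 ** ?B1 ** Rmat p p') (?A2 ** ?B1) (0 + ?A2 ** ?B1 ** (- ?\<rho>))"
    using mult[OF mult[OF const[of h ?A2] const[of h ?B1]] R] by (simp only: simps)
  show "\<exists>C. ?B1 ** ?A2 - ?A2 ** ?B1 = map_matrix ((*) h)
      (- (?B1 ** transp2 ?\<rho> ** ?A2) - ?B1 ** ?A2 ** ?\<rho>) + map_matrix ((*) (h\<^sup>2)) C"
  proof -
    have "0 + ?B1 ** ?A2 ** (- ?\<rho>) - ?B1 ** transp2 ?\<rho> ** ?A2 =
      - (?B1 ** transp2 ?\<rho> ** ?A2) - ?B1 ** ?A2 ** ?\<rho>"
      by (simp add: simps)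
    then show ?thesis
      using first_order_commutator[OF h 5 6[unfolded AB]] by (simp only:)
  qed
qed

subsection \<open>The semiclassical limit\<close>

lemma ex_order_reversal: "\<exists>w :: 'n::{finite,linorder} \<Rightarrow> 'n. \<forall>i j. i < j \<longrightarrow> w j < w i"
proof (intro exI allI impI)
  let ?xs = "sorted_list_of_set (UNIV :: 'n set)"
  fix i j :: 'n assume "i < j"
  have "card {y. j < y} < card {y. i < y}"
    using \<open>i < j\<close> by (intro psubset_card_mono) auto
  moreover have "card {y. i < y} < card (UNIV :: 'n set)"
    by (intro psubset_card_mono) auto
  moreover have "sorted_wrt (<) ?xs"
    by (rule strict_sorted_list_of_set)
  \<comment> \<open>This instantiates \<open>w\<close>: an index is sent to the element at the
    position, counted from 0, given by the number of indices above it.\<close>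
  ultimately show "?xs ! card {y. j < y} < ?xs ! card {y. i < y}"
    by (intro sorted_wrt_nth_less[of "(<)" ?xs]) simp_all
qed

section \<open>Renumbering the indices\<close>

definition reindex2 :: "('n::finite \<Rightarrow> 'n) \<Rightarrow> ('a, 'n) mat2 \<Rightarrow> ('a, 'n) mat2" where
  "reindex2 w M = (\<chi> x y. M $ (w (fst x), w (snd x)) $ (w (fst y), w (snd y)))"

lemma reindex2_nth [simp]: "reindex2 w M $ (i, k) $ (j, l) = M $ (w i, w k) $ (w j, w l)"
  by (simp add: reindex2_def)

lemma reindex2_leg:
  assumes "inj w"
  shows "reindex2 w (leg1 X) = leg1 (reindex w X)" "reindex2 w (leg2 X) = leg2 (reindex w X)"
  using assms by (auto intro!: mat2_eqI simp: leg1_nth leg2_nth reindex_def inj_eq)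

lemma reindex2_mult:
  fixes M N :: "('a::semiring_1, 'n::finite) mat2"
  assumes "bij w"
  shows "reindex2 w (M ** N) = reindex2 w M ** reindex2 w N"
proof (rule mat2_eqI)
  fix i k j l
  have "(\<Sum>a\<in>UNIV. \<Sum>b\<in>UNIV. f (w a) (w b)) = (\<Sum>a\<in>UNIV. \<Sum>b\<in>UNIV. f a b)" for f :: "'n \<Rightarrow> 'n \<Rightarrow> 'a"
    using sum.reindex_bij_betw[OF assms, of "\<lambda>a. \<Sum>b\<in>UNIV. f a b"]
    by (simp add: sum.reindex_bij_betw[OF assms, of "f (w a)" for a])
  from this[of "\<lambda>a b. M $ (w i, w k) $ (a, b) * N $ (a, b) $ (w j, w l)"]
  show "reindex2 w (M ** N) $ (i, k) $ (j, l) = (reindex2 w M ** reindex2 w N) $ (i, k) $ (j, l)"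
    by (simp add: matrix_matrix_mult_def sum_UNIV_prod)
qed

lemma reindex2_simps:
  "reindex2 w (M + N) = reindex2 w M + reindex2 w N"
  "reindex2 w (M' - N') = reindex2 w M' - reindex2 w N'"
  "reindex2 w (- N') = - reindex2 w N'"
  "reindex2 w (map_matrix f M) = map_matrix f (reindex2 w M)"
  "reindex2 w (transp1 M) = transp1 (reindex2 w M)"
  "reindex2 w (transp2 M) = transp2 (reindex2 w M)"
  for M' N' :: "('a::group_add, 'n::finite) mat2"
  by (auto intro!: mat2_eqI)

lemma rmat_nth:
  "rmat $ (i, k) $ (j, l) = (if (j, l) = (i, k) then if i = k then 1 else 0 else 0) +
     (if (j, l) = (k, i) then if k < i then 2 else 0 else (0::'a::ring_1))"
  for i j k l :: "'n::{finite,linorder}"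
proof -
  have diag: "(\<Sum>a\<in>UNIV. tensor (mat_unit a a) (mat_unit a a)) $ (i, k) $ (j, l) =
      (if (j, l) = (i, k) then if i = k then 1 else 0 else (0::'a))"
  proof -
    have "(\<Sum>a\<in>UNIV. tensor (mat_unit a a) (mat_unit a a)) $ (i, k) $ (j, l) =
      (\<Sum>a\<in>UNIV. if a = i then if j = i \<and> k = i \<and> l = i then 1 else (0::'a) else 0)"
      unfolding sum_component
      by (intro sum.cong) (auto simp: tensor_def mat_unit_def)
    then show ?thesis by auto
  qed
  have off: "(\<Sum>(a, b)\<in>{(a, b). a > b}. tensor (mat_unit a b) (mat_unit b a)) $ (i, k) $ (j, l) =
      (if (j, l) = (k, i) then if k < i then 1 else 0 else (0::'a))"
  proof -
    have "(\<Sum>(a, b)\<in>{(a, b). a > b}. tensor (mat_unit a b) (mat_unit b a)) $ (i, k) $ (j, l) =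
      (\<Sum>x\<in>{(a, b). a > b}. if x = (i, j) then if k = j \<and> l = i then 1 else (0::'a) else 0)"
      unfolding sum_component
      by (intro sum.cong) (auto simp: tensor_def mat_unit_def split: if_splits)
    then show ?thesis by auto
  qed
  show ?thesis
    unfolding rmat_def vector_add_component nth_map_matrix diag off by simp
qed

lemma reindex2_rmat_opp:
  assumes "\<And>i j. i < j \<Longrightarrow> w j < w i"
  shows "reindex2 w rmat_opp = rmat"
proof (rule mat2_eqI)
  fix i k j l :: 'a
  have less: "w x < w y \<longleftrightarrow> y < x" for x y
    using assms by (metis less_asym neq_iff)
  have eq: "w x = w y \<longleftrightarrow> x = y" for x y
    using assms by (metis less_irrefl neq_iff)
  show "reindex2 w rmat_opp $ (i, k) $ (j, l) = rmat $ (i, k) $ (j, l)"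
    unfolding reindex2_nth rmat_nth rmat_opp_def vec_lambda_beta fst_conv snd_conv prod.inject less eq ..
qed

text \<open>The series 2 is a unit because its constant coefficient is nonzero in characteristic 0.
  This is the division law required by \<open>qR_eq_Rmat\<close>.\<close>

lemma fps_half:
  fixes x :: "'k::field_char_0 fps"
  shows "x / 2 + x / 2 = x"
proof -
  have "x / 2 = x * inverse 2"
    by (rule fps_divide_unit) simp
  moreover have "(2 :: 'k fps) * inverse 2 = 1"
    by (rule inverse_mult_eq_1') simp
  ultimately show ?thesis
    by (metis mult.right_neutral mult.assoc mult.commute mult_2)
qed

lemma qR_fps_exp:
  fixes a :: "'k::field_char_0"
  shows "qR (fps_exp a) = Rmat (fps_exp (2 * a)) (fps_exp (- 2 * a))"
    and "qR (inverse (fps_exp a)) = Rmat (fps_exp (- 2 * a)) (fps_exp (2 * a))"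
proof -
  have sq: "(fps_exp b)\<^sup>2 = fps_exp (2 * b)" for b :: 'k
    by (simp add: fps_exp_power_mult)
  have inv: "inverse (fps_exp b) = fps_exp (- b)" for b :: 'k
    by (simp add: fps_exp_neg)
  have "qR (fps_exp b) = Rmat ((fps_exp b)\<^sup>2) (inverse ((fps_exp b)\<^sup>2))" for b :: 'k
    by (rule qR_eq_Rmat[OF fps_half]) (simp_all add: inverse_mult_eq_1' fps_inverse_power)
  then have *: "qR (fps_exp b) = Rmat (fps_exp (2 * b)) (fps_exp (- 2 * b))" for b :: 'k
    by (simp add: sq inv)
  show "qR (fps_exp a) = Rmat (fps_exp (2 * a)) (fps_exp (- 2 * a))"
    by (rule *)
  show "qR (inverse (fps_exp a)) = Rmat (fps_exp (- 2 * a)) (fps_exp (2 * a))"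
    using *[of "- a"] by (simp add: inv)
qed

lemma fps_exp_expansion: "\<exists>u. fps_exp a = 1 + fps_const a * fps_X + fps_X\<^sup>2 * u"
  for a :: "'k::field_char_0"
proof -
  have "fps_cutoff 2 (fps_exp a) = 1 + fps_const a * fps_X"
    by (rule fps_ext) (auto simp: fps_X_def less_2_cases_iff)
  then show ?thesis
    by (metis fps_shift_cutoff' add.commute)
qed

lemma semiclassical_limit_quantum:
  fixes \<kappa> :: "'k::field_char_0 fps \<Rightarrow> 'h::ring_1" and A B :: "('h, 'n::{finite,linorder}) mat1"
  assumes \<kappa>: "algebra_map \<kappa>" and rel: "quantum_relations \<kappa> (fps_exp (- 1 / 2)) A B"
    and w: "\<And>i j. i < j \<Longrightarrow> w j < w i"
  shows "semiclassical_limit \<kappa> w A B"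
proof -
  define h where "h = \<kappa> fps_X"
  define p where "p = \<kappa> (fps_exp (- 1))"
  define p' where "p' = \<kappa> (fps_exp 1)"
  have add: "\<kappa> (x + y) = \<kappa> x + \<kappa> y" and mult: "\<kappa> (x * y) = \<kappa> x * \<kappa> y"
    and one: "\<kappa> 1 = 1" and central: "\<kappa> x * u = u * \<kappa> x" for x y u
    using \<kappa> unfolding algebra_map_def by blast+
  have zero: "\<kappa> 0 = 0"
    using add[of 0 0] by simp
  have minus: "\<kappa> (- x) = - \<kappa> x" for x
    using add[of "- x" x] zero by (simp add: eq_neg_iff_add_eq_0)
  \<comment> \<open>The parameter is the square root of q, so exp(-h/2) corresponds to q =
    exp(-h).\<close>
  have qR: "qR (fps_exp (- 1 / 2 :: 'k)) = Rmat (fps_exp (- 1)) (fps_exp 1)"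
    "qR (inverse (fps_exp (- 1 / 2 :: 'k))) = Rmat (fps_exp 1) (fps_exp (- 1))"
    using qR_fps_exp[of "- 1 / 2 :: 'k"] by simp_all
  note defs = quantum_relations_def AA_lhs_def AA_rhs_def BB_lhs_def BB_rhs_def AB_lhs_def AB_rhs_def
  have rels: "Rmat p p' ** leg1 A ** transp1 (Rmat p p') ** leg2 A =
      leg2 A ** transp1 (Rmat p p') ** leg1 A ** Rmat p p'"
    "Rmat p p' ** leg1 B ** leg2 B = leg2 B ** leg1 B ** Rmat p p'"
    "leg2 A ** leg1 B ** Rmat p p' = leg1 B ** transp2 (Rmat p' p) ** leg2 A"
    using rel unfolding defs qR map_matrix_Rmat[OF \<kappa>] p_def p'_def by blast+
  obtain u where "fps_exp (- 1 :: 'k) = 1 + fps_const (- 1) * fps_X + fps_X\<^sup>2 * u"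
    using fps_exp_expansion by blast
  then have "p = \<kappa> (1 + (- fps_X) + fps_X\<^sup>2 * u)"
    by (simp add: p_def fps_const_neg[symmetric] del: fps_const_neg)
  then have p: "p = 1 - h + h\<^sup>2 * \<kappa> u"
    by (simp only: add mult one minus h_def power2_eq_square diff_conv_add_uminus)
  obtain u' where "fps_exp (1 :: 'k) = 1 + fps_const 1 * fps_X + fps_X\<^sup>2 * u'"
    using fps_exp_expansion by blast
  then have "p' = \<kappa> (1 + fps_X + fps_X\<^sup>2 * u')"
    by (simp add: p'_def)
  then have p': "p' = 1 + h + h\<^sup>2 * \<kappa> u'"
    by (simp only: add mult one h_def power2_eq_square)
  have "inj w"
    using w by (metis injI less_irrefl neq_iff)
  then have "bij w"
    by (simp add: bij_def finite_UNIV_inj_surj)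
  have "reindex2 w rmat_opp = (rmat :: ('h, 'n) mat2)"
    using w by (rule reindex2_rmat_opp)
  note reindex = this reindex2_simps reindex2_mult[OF \<open>bij w\<close>] reindex2_leg[OF \<open>inj w\<close>]
  \<comment> \<open>Renumbering respects sums, products, legs and partial transpositions, so it
    carries the expansions with \<open>rmat_opp\<close> to those with \<open>rmat\<close>.\<close>
  have limit: "\<exists>C. reindex2 w L = map_matrix ((*) h) (reindex2 w M) + map_matrix ((*) (h\<^sup>2)) C"
    if L: "\<exists>C. L = map_matrix ((*) h) M + map_matrix ((*) (h\<^sup>2)) C" for L M :: "('h, 'n) mat2"
  proof -
    obtain C where "L = map_matrix ((*) h) M + map_matrix ((*) (h\<^sup>2)) C"
      using L by blast
    then have "reindex2 w L = map_matrix ((*) h) (reindex2 w M) + map_matrix ((*) (h\<^sup>2)) (reindex2 w C)"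
      by (simp add: reindex2_simps)
    then show ?thesis by blast
  qed
  have h: "h * x = x * h" for x
    unfolding h_def by (rule central)
  show ?thesis
    unfolding semiclassical_limit_def Let_def commutator_limit_def bracket_AA_def bracket_BB_def
      bracket_BA_def h_def[symmetric]
    using semiclassical_commutators[OF h p p' rels, THEN limit]
    unfolding reindex by (intro conjI)
qed

theorem lemma8p1:
  fixes s :: "'k::field_char_0"
    and \<iota> :: "'k \<Rightarrow> 'r::ring_1"
    and A B :: "('r, 'n::{finite,linorder}) mat1"
    and \<kappa> :: "'k fps \<Rightarrow> 'h::ring_1"
    and A\<^sub>h B\<^sub>h :: "('h, 'n) mat1"
  assumes "s \<noteq> 0"
  shows
    "jacobi_relations TYPE('n) s \<and>
     (algebra_map \<iota> \<longrightarrow> quantum_relations \<iota> s A B \<longrightarrow>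
        AA_lhs \<iota> s (B ** A ** transpose B) = AA_rhs \<iota> s (B ** A ** transpose B)) \<and>
     (algebra_map \<kappa> \<longrightarrow> quantum_relations \<kappa> (fps_exp (- 1 / 2)) A\<^sub>h B\<^sub>h \<longrightarrow>
        (\<exists>w. (\<forall>i j. i < j \<longrightarrow> w j < w i) \<and> semiclassical_limit \<kappa> w A\<^sub>h B\<^sub>h))"
proof (intro conjI impI)
  show "jacobi_relations TYPE('n) s"
    using assms by (rule jacobi_relations_qR)
next
  assume \<iota>: "algebra_map \<iota>" and rel: "quantum_relations \<iota> s A B"
  interpret central_unit_pair "\<iota> (s\<^sup>2)" "\<iota> (inverse (s\<^sup>2))"
    by (rule central_unit_pair_algebra_map[OF \<iota>]) (use assms in simp)
  note defs = quantum_relations_def AA_lhs_def AA_rhs_def BB_lhs_def BB_rhs_def AB_lhs_def AB_rhs_def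
    qR_field[OF assms] map_matrix_Rmat[OF \<iota>]
  show "AA_lhs \<iota> s (B ** A ** transpose B) = AA_rhs \<iota> s (B ** A ** transpose B)"
    using rel unfolding defs by (intro quantum_automorphism) blast+
next
  assume "algebra_map \<kappa>" "quantum_relations \<kappa> (fps_exp (- 1 / 2)) A\<^sub>h B\<^sub>h"
  moreover obtain w :: "'n \<Rightarrow> 'n" where "\<forall>i j. i < j \<longrightarrow> w j < w i"
    using ex_order_reversal by blast
  ultimately show "\<exists>w. (\<forall>i j. i < j \<longrightarrow> w j < w i) \<and> semiclassical_limit \<kappa> w A\<^sub>h B\<^sub>h"
    using semiclassical_limit_quantum by blast
qed

end
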